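(* Let $n\ge1$ and $0\le r\le n$ be integers and let $\Lambda=(\lambda_{i,j})\in M_n(k^* )$ be multiplicatively antisymmetric. Suppose moreover that $\Lambda$ satisfies one of the following three equivalent conditions: (1) $\mathcal O_\Lambda({k^*}^n)$ is simple; (2) the centre of $\mathcal O_\Lambda({k^*}^n)$ is $k$; (3) there is no $\alpha\in\mathbb Z^n\setminus\{0\}$ such that $\lambda_{1,j}^{\alpha_1}\cdots\lambda_{n,j}^{\alpha_n}=1$ for all $1\le j\le n$. Then $\mathcal O_\Lambda({k^*}^n)$ is a simple maximal quantum sub-torus of $\operatorname{Frac}(S_{n,r}^{\Lambda}(k))$ (that is, it is a maximal quantum sub-torus and is a simple algebra).
   Context: $k$ is a field of characteristic $0$; all morphisms are morphisms of $k$-algebras. A matrix $\Lambda=(\lambda_{i,j})\in M_n(k^* )$ is multiplicatively antisymmetric if $\lambda_{i,j}\lambda_{j,i}=\lambda_{i,i}=1$ for all $i,j$. The quantum torus $\mathcal O_\Lambda({k^*}^n)=k_\Lambda[y_1^{\pm1},\dots,y_n^{\pm1}]$ is the $k$-algebra generated by $y_1^{\pm1},\dots,y_n^{\pm1}$ with relations $y_iy_j=\lambda_{i,j}y_jy_i$. $\mathcal O_\Lambda({k^*}^n)$ is called a maximal quantum sub-torus of a $k$-algebra $A$ if (1) $A$ has a subalgebra $k$-isomorphic to $\mathcal O_\Lambda({k^*}^n)$; and (2) for every quantum torus $\mathcal O_M({k^*}^m)$, with $m\ge1$ and $M\in M_m(k^* )$ multiplicatively antisymmetric, if there exists an algebra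 morphism $\mathcal O_M({k^*}^m)\to A$, then there exists an algebra morphism $\mathcal O_M({k^*}^m)\to\mathcal O_\Lambda({k^*}^n)$. For integers $n\ge1$, $0\le r\le n$ and multiplicatively antisymmetric $\Lambda$, $S_{n,r}^{\Lambda}(k)$ is the $k$-algebra generated by $y_1,\dots,y_n,x_1,\dots,x_r$ with relations: $y_iy_j=\lambda_{i,j}y_jy_i$ ($1\le i,j\le n$); $x_iy_i=y_ix_i+1$ ($1\le i\le r$); $x_iy_j=\lambda_{i,j}^{-1}y_jx_i$ ($1\le i\le r$, $1\le j\le n$, $i\ne j$); $x_ix_j=\lambda_{i,j}x_jx_i$ ($1\le i,j\le r$). It is a noetherian domain and $\operatorname{Frac}$ denotes its skew field of fractions. *)

theory Defs
  imports
    "HOL-Library.Poly_Mapping"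
    "HOL-Algebra.QuotRing"
    "HOL-Algebra.Subrings"
    "HOL-Algebra.Algebraic_Closure_Type"
begin

section \<open>Algebras over a field\<close>

text \<open>
  The ground field is the type \<open>'k\<close>; algebras are carrier-based records, because a single
  type has to contain the quantum tori of all ranks and all parameter matrices.
  The locale \<^locale>\<open>algebra\<close> of the library is restricted to commutative algebras.
\<close>

locale k_algebra =
  module "ring_of_type_algebra :: 'k::field ring" A + ring A
  for A :: "('k::field, 'a) module" (structure) +
  assumes smult_mult_left:
      "\<lbrakk>x \<in> carrier A; y \<in> carrier A\<rbrakk> \<Longrightarrow> (c \<odot> x) \<otimes> y = c \<odot> (x \<otimes> y)"
    and smult_mult_right:
      "\<lbrakk>x \<in> carrier A; y \<in> carrier A\<rbrakk> \<Longrightarrow> x \<otimes> (c \<odot> y) = c \<odot> (x \<otimes> y)"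

definition alg_hom :: "('k, 'a) module \<Rightarrow> ('k, 'b) module \<Rightarrow> ('a \<Rightarrow> 'b) set" where
  "alg_hom A B = {h \<in> ring_hom A B. \<forall>c. \<forall>x\<in>carrier A. h (c \<odot>\<^bsub>A\<^esub> x) = c \<odot>\<^bsub>B\<^esub> h x}"

definition alg_iso :: "('k, 'a) module \<Rightarrow> ('k, 'b) module \<Rightarrow> ('a \<Rightarrow> 'b) set" where
  "alg_iso A B = {h \<in> alg_hom A B. bij_betw h (carrier A) (carrier B)}"

definition is_subalgebra :: "'a set \<Rightarrow> ('k, 'a) module \<Rightarrow> bool" where
  "is_subalgebra B A \<longleftrightarrow> subring B A \<and> (\<forall>c. \<forall>x\<in>B. c \<odot>\<^bsub>A\<^esub> x \<in> B)"

definition simple_algebra :: "('k, 'a) module \<Rightarrow> bool" where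
  "simple_algebra A \<longleftrightarrow>
     carrier A \<noteq> {\<zero>\<^bsub>A\<^esub>} \<and> (\<forall>I. ideal I A \<longrightarrow> I = {\<zero>\<^bsub>A\<^esub>} \<or> I = carrier A)"

definition centre :: "('k, 'a) module \<Rightarrow> 'a set" where
  "centre A = {z \<in> carrier A. \<forall>x\<in>carrier A. z \<otimes>\<^bsub>A\<^esub> x = x \<otimes>\<^bsub>A\<^esub> z}"

definition scalars :: "('k, 'a) module \<Rightarrow> 'a set" where
  "scalars A = range (\<lambda>c. c \<odot>\<^bsub>A\<^esub> \<one>\<^bsub>A\<^esub>)"

definition skew_field :: "('a, 'm) ring_scheme \<Rightarrow> bool" where
  "skew_field D \<longleftrightarrow> ring D \<and> Units D = carrier D - {\<zero>\<^bsub>D\<^esub>}"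

text \<open>
  \<open>D\<close>, with the embedding \<open>\<iota>\<close>, is the skew field of right fractions \<open>\<iota> a (\<iota> b)\<^sup>-\<^sup>1\<close> of \<open>S\<close>.
  These conditions determine \<open>(D, \<iota>)\<close> up to a unique isomorphism. For a (two-sided)
  noetherian domain, right and left fractions give the same skew field.
\<close>

definition skew_field_of_fractions ::
  "('k::field, 'a) module \<Rightarrow> ('k, 'd) module \<Rightarrow> ('a \<Rightarrow> 'd) \<Rightarrow> bool" where
  "skew_field_of_fractions S D \<iota> \<longleftrightarrow>
     k_algebra D \<and> skew_field D \<and> \<iota> \<in> alg_hom S D \<and> inj_on \<iota> (carrier S) \<and>
     (\<forall>d\<in>carrier D. \<exists>a\<in>carrier S. \<exists>b\<in>carrier S - {\<zero>\<^bsub>S\<^esub>}. d = \<iota> a \<otimes>\<^bsub>D\<^esub> inv\<^bsub>D\<^esub> (\<iota> b))"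


section \<open>Algebras given by generators and relations\<close>

text \<open>
  Words are wrapped in a type of their own to make them an additively written monoid:
  then the multiplication of \<open>'g word \<Rightarrow>\<^sub>0 'k\<close> is that of the monoid algebra, which is the
  free algebra on \<open>'g\<close>.
\<close>

datatype 'g word = Word (letters: "'g list")

instantiation word :: (type) monoid_add
begin

definition zero_word :: "'a word" where
  "zero_word = Word []"

definition plus_word :: "'a word \<Rightarrow> 'a word \<Rightarrow> 'a word" where
  "plus_word u v = Word (letters u @ letters v)"

instance
  by standard (simp_all add: zero_word_def plus_word_def)

end

definition gen :: "'g \<Rightarrow> ('g word \<Rightarrow>\<^sub>0 'k::field)" where
  "gen g = Poly_Mapping.single (Word [g]) 1"

definition const :: "'k::field \<Rightarrow> ('g word \<Rightarrow>\<^sub>0 'k)" where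
  "const c = Poly_Mapping.single 0 c"

definition free_algebra :: "'g set \<Rightarrow> ('k::field, 'g word \<Rightarrow>\<^sub>0 'k) module" where
  "free_algebra G =
     \<lparr>carrier = {p. \<forall>w\<in>Poly_Mapping.keys p. set (letters w) \<subseteq> G},
      monoid.mult = (*), one = 1, zero = 0, add = (+), module.smult = (\<lambda>c p. const c * p)\<rparr>"

definition quotient_algebra :: "('k, 'a) module \<Rightarrow> 'a set \<Rightarrow> ('k, 'a set) module" where
  "quotient_algebra A I =
     ring.extend (A Quot I) (module.fields (\<lambda>c C. \<Union>x\<in>C. I +>\<^bsub>A\<^esub> (c \<odot>\<^bsub>A\<^esub> x)))"

text \<open>A relation \<open>p = q\<close> is represented by the pair \<open>(p, q)\<close>.\<close>

definition relation_ideal ::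
  "'g set \<Rightarrow> (('g word \<Rightarrow>\<^sub>0 'k::field) \<times> ('g word \<Rightarrow>\<^sub>0 'k)) set \<Rightarrow> ('g word \<Rightarrow>\<^sub>0 'k) set" where
  "relation_ideal G R = genideal (free_algebra G) {p - q | p q. (p, q) \<in> R}"

definition presented_algebra ::
  "'g set \<Rightarrow> (('g word \<Rightarrow>\<^sub>0 'k::field) \<times> ('g word \<Rightarrow>\<^sub>0 'k)) set \<Rightarrow>
   ('k, ('g word \<Rightarrow>\<^sub>0 'k) set) module" where
  "presented_algebra G R = quotient_algebra (free_algebra G) (relation_ideal G R)"

lemma free_algebra_simps [simp]:
  "carrier (free_algebra G) = {p. \<forall>w\<in>Poly_Mapping.keys p. set (letters w) \<subseteq> G}"
  "monoid.mult (free_algebra G) = (*)" "one (free_algebra G) = 1"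
  "zero (free_algebra G) = 0" "add (free_algebra G) = (+)"
  "module.smult (free_algebra G) = (\<lambda>c p. const c * p)"
  by (simp_all add: free_algebra_def)

lemma quotient_algebra_simps [simp]:
  "carrier (quotient_algebra A I) = carrier (A Quot I)"
  "monoid.mult (quotient_algebra A I) = monoid.mult (A Quot I)"
  "one (quotient_algebra A I) = one (A Quot I)"
  "zero (quotient_algebra A I) = zero (A Quot I)"
  "add (quotient_algebra A I) = add (A Quot I)"
  "module.smult (quotient_algebra A I) = (\<lambda>c C. \<Union>x\<in>C. I +>\<^bsub>A\<^esub> (c \<odot>\<^bsub>A\<^esub> x))"
  by (simp_all add: quotient_algebra_def ring.extend_def module.fields_def)

lemma keys_mult_word:
  fixes p q :: "'g word \<Rightarrow>\<^sub>0 'k::field"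
  assumes "\<forall>w\<in>Poly_Mapping.keys p. set (letters w) \<subseteq> G"
    and "\<forall>w\<in>Poly_Mapping.keys q. set (letters w) \<subseteq> G"
  shows "\<forall>w\<in>Poly_Mapping.keys (p * q). set (letters w) \<subseteq> G"
  using assms keys_mult[of p q] by (fastforce simp: plus_word_def)

lemma keys_const_word:
  "\<forall>w\<in>Poly_Mapping.keys (const c). set (letters w) \<subseteq> G"
  by (auto simp: const_def zero_word_def)

lemma const_simps:
  "const (a + b) = const a + const b"
  "const (a * b) = const a * const b"
  "const 1 = 1"
  by (simp_all add: const_def single_add mult_single)

lemma const_commute: "p * const c = const c * p"
proof (induction p rule: update_induct)
  case const
  then show ?case by simp
next
  case (update f a b)
  have "Poly_Mapping.update a b f = f + Poly_Mapping.single a b"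
    using update by (intro poly_mapping_eqI) (auto simp: lookup_update lookup_add lookup_single in_keys_iff when_def)
  moreover have "Poly_Mapping.single a b * const c = const c * Poly_Mapping.single a b"
    by (simp add: const_def mult_single mult.commute)
  ultimately show ?case using update by (simp add: distrib_left distrib_right)
qed

lemma free_algebra_ring: "ring (free_algebra G :: ('k::field, 'g word \<Rightarrow>\<^sub>0 'k) module)"
  (is "ring ?A")
proof (rule ringI)
  show "abelian_group ?A"
  proof (rule abelian_groupI)
    fix x y assume "x \<in> carrier ?A" "y \<in> carrier ?A"
    then show "x \<oplus>\<^bsub>?A\<^esub> y \<in> carrier ?A"
      using Poly_Mapping.keys_add[of x y] by fastforce
  next
    fix x assume "x \<in> carrier ?A"
    then show "\<exists>y\<in>carrier (free_algebra G). y \<oplus>\<^bsub>?A\<^esub> x = \<zero>\<^bsub>?A\<^esub>"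
      by (intro bexI[of _ "- x"]) auto
  qed (simp_all add: add_ac)
  show "Group.monoid ?A"
  proof (rule monoidI)
    show "\<one>\<^bsub>?A\<^esub> \<in> carrier ?A"
      using keys_const_word[of "1 :: 'k" G] by (simp only: const_simps) simp
  qed (use keys_mult_word in \<open>simp_all add: mult.assoc\<close>)
qed (simp_all add: distrib_left distrib_right)

lemma free_algebra_k_algebra:
  "k_algebra (free_algebra G :: ('k::field, 'g word \<Rightarrow>\<^sub>0 'k) module)"
proof -
  interpret ring "free_algebra G :: ('k, 'g word \<Rightarrow>\<^sub>0 'k) module" by (rule free_algebra_ring)
  have mem: "const c * p \<in> carrier (free_algebra G)"
    if "p \<in> carrier (free_algebra G)" for c :: 'k and p :: "'g word \<Rightarrow>\<^sub>0 'k"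
    using that keys_mult_word[OF keys_const_word, of p G c] by simp
  have "module ring_of_type_algebra (free_algebra G :: ('k, 'g word \<Rightarrow>\<^sub>0 'k) module)"
    by (intro moduleI abelian_group_axioms cring_from_type_algebra)
       (use mem in \<open>simp_all add: ring_of_type_algebra_def const_simps algebra_simps\<close>)
  then show ?thesis
    by (intro k_algebra.intro free_algebra_ring k_algebra_axioms.intro)
       (simp_all add: mult.assoc[symmetric] const_commute)
qed

lemma (in k_algebra) ideal_smult:
  assumes "ideal I A" "x \<in> I"
  shows "c \<odot> x \<in> I"
proof -
  interpret I: ideal I A by fact
  have x: "x \<in> carrier A" using assms I.Icarr by blast
  have c: "c \<odot> \<one> \<in> carrier A" by (rule smult_closed) (auto simp: ring_of_type_algebra_def)
  have "c \<odot> x = (c \<odot> \<one>) \<otimes> x" using x by (simp add: smult_mult_left)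
  then show ?thesis using I.I_l_closed[OF assms(2) c] by simp
qed

lemma (in k_algebra) quotient_smult:
  assumes "ideal I A" "x \<in> carrier A"
  shows "(\<Union>y\<in>I +> x. I +> (c \<odot> y)) = I +> (c \<odot> x)"
proof -
  interpret I: ideal I A by fact
  have cl: "c \<odot> y \<in> carrier A" if "y \<in> carrier A" for y
    using that by (rule smult_closed[rotated]) (auto simp: ring_of_type_algebra_def)
  have "I +> (c \<odot> y) = I +> (c \<odot> x)" if y: "y \<in> I +> x" for y
  proof -
    obtain i where i: "i \<in> I" "y = i \<oplus> x"
      using y by (auto simp: a_r_coset_def')
    have "c \<odot> y = (c \<odot> i) \<oplus> (c \<odot> x)"
      using i assms I.Icarr smult_r_distr[of c i x] by (auto simp: ring_of_type_algebra_def)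
    then have "c \<odot> y \<in> I +> (c \<odot> x)"
      using ideal_smult[OF assms(1) i(1)] by (auto simp: a_r_coset_def')
    then show ?thesis
      using cl[OF assms(2)] I.a_repr_independence' by metis
  qed
  moreover have "x \<in> I +> x" using I.a_rcos_self assms by blast
  ultimately show ?thesis by blast
qed

lemma (in k_algebra) quotient_k_algebra:
  assumes "ideal I A"
  shows "k_algebra (quotient_algebra A I)"
proof -
  interpret I: ideal I A by fact
  have cl: "c \<odot> y \<in> carrier A" if "y \<in> carrier A" for c y
    using that by (rule smult_closed[rotated]) (auto simp: ring_of_type_algebra_def)
  have carr: "carrier (A Quot I) = (\<lambda>x. I +> x) ` carrier A"
    by (auto simp: FactRing_simps)
  have Q: "ring (A Quot I)" by (rule I.quotient_is_ring)
  interpret Q: ring "A Quot I" by (rule Q)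
  have r: "ring (quotient_algebra A I)"
  proof (rule ringI)
    show "abelian_group (quotient_algebra A I)"
    proof (rule abelian_groupI)
      fix x assume "x \<in> carrier (quotient_algebra A I)"
      then show "\<exists>y\<in>carrier (quotient_algebra A I).
          y \<oplus>\<^bsub>quotient_algebra A I\<^esub> x = \<zero>\<^bsub>quotient_algebra A I\<^esub>"
        using Q.a_inv_closed Q.l_neg by auto
    qed (simp_all add: Q.a_ac)
    show "Group.monoid (quotient_algebra A I)"
      by (rule monoidI) (simp_all add: Q.m_assoc)
  qed (simp_all add: Q.l_distr Q.r_distr)
  have ad: "(I +> x) \<oplus>\<^bsub>A Quot I\<^esub> (I +> y) = I +> (x \<oplus> y)"
    if "x \<in> carrier A" "y \<in> carrier A" for x y
    using that by (simp add: FactRing_def I.a_rcos_sum)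
  have mu: "(I +> x) \<otimes>\<^bsub>A Quot I\<^esub> (I +> y) = I +> (x \<otimes> y)"
    if "x \<in> carrier A" "y \<in> carrier A" for x y
    using that by (simp add: FactRing_def I.rcoset_mult_add)
  have sm: "c \<odot>\<^bsub>quotient_algebra A I\<^esub> (I +> x) = I +> (c \<odot> x)" if "x \<in> carrier A" for c x
    using quotient_smult[OF assms that] by simp
  have distr: "(a + b) \<odot> x = (a \<odot> x) \<oplus> (b \<odot> x)" "(a * b) \<odot> x = a \<odot> (b \<odot> x)" "1 \<odot> x = x"
    if "x \<in> carrier A" for a b x
    using that smult_l_distr[of a b x] smult_assoc1[of a b x] smult_one[of x]
    by (auto simp: ring_of_type_algebra_def)
  have rdistr: "a \<odot> (x \<oplus> y) = (a \<odot> x) \<oplus> (a \<odot> y)"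
    if "x \<in> carrier A" "y \<in> carrier A" for a x y
    using that smult_r_distr[of a x y] by (auto simp: ring_of_type_algebra_def)
  interpret q: ring "quotient_algebra A I" by (rule r)
  have "module ring_of_type_algebra (quotient_algebra A I)"
    by (intro moduleI q.abelian_group_axioms cring_from_type_algebra)
       (auto simp: carr sm ad cl distr rdistr ring_of_type_algebra_def
         simp del: quotient_algebra_simps(6))
  then show ?thesis
    by (intro k_algebra.intro r k_algebra_axioms.intro)
       (auto simp: carr sm mu cl smult_mult_left smult_mult_right
         simp del: quotient_algebra_simps(6))
qed

lemma keys_gen_word: "g \<in> G \<Longrightarrow> \<forall>w\<in>Poly_Mapping.keys (gen g). set (letters w) \<subseteq> G"
  by (simp add: gen_def)

lemma keys_add_word:
  assumes "\<forall>w\<in>Poly_Mapping.keys p. set (letters w) \<subseteq> G"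
    and "\<forall>w\<in>Poly_Mapping.keys q. set (letters w) \<subseteq> G"
  shows "\<forall>w\<in>Poly_Mapping.keys (p + q). set (letters w) \<subseteq> G"
  using assms Poly_Mapping.keys_add[of p q] by fastforce

lemma keys_one_word:
  "\<forall>w\<in>Poly_Mapping.keys (1 :: 'g word \<Rightarrow>\<^sub>0 'k::field). set (letters w) \<subseteq> G"
  using keys_const_word[of "1 :: 'k" G] by (simp only: const_simps)

lemmas keys_word_intros =
  keys_mult_word keys_add_word keys_const_word keys_one_word keys_gen_word

lemma presented_algebra_k_algebra:
  assumes "\<And>p q. (p, q) \<in> R \<Longrightarrow> p \<in> carrier (free_algebra G) \<and> q \<in> carrier (free_algebra G)"
  shows "k_algebra (presented_algebra G R)"
proof -
  interpret F: ring "free_algebra G" by (rule free_algebra_ring)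
  have "p - q \<in> carrier (free_algebra G)" if "(p, q) \<in> R" for p q
    using assms[OF that] keys_diff[of p q] by fastforce
  then have "ideal (relation_ideal G R) (free_algebra G)"
    unfolding relation_ideal_def by (intro F.genideal_ideal) blast
  then show ?thesis
    unfolding presented_algebra_def
    by (rule k_algebra.quotient_k_algebra[OF free_algebra_k_algebra])
qed


section \<open>Quantum tori\<close>

text \<open>Only the entries with indices in \<open>{1..n}\<close> of \<open>\<Lambda>\<close> are significant.\<close>

definition mult_antisymmetric :: "nat \<Rightarrow> (nat \<Rightarrow> nat \<Rightarrow> 'k::field) \<Rightarrow> bool" where
  "mult_antisymmetric n \<Lambda> \<longleftrightarrow>
     (\<forall>i\<in>{1..n}. \<forall>j\<in>{1..n}. \<Lambda> i j \<noteq> 0 \<and> \<Lambda> i j * \<Lambda> j i = 1 \<and> \<Lambda> i i = 1)"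

datatype torus_gen = TY nat | TYinv nat

definition quantum_torus ::
  "nat \<Rightarrow> (nat \<Rightarrow> nat \<Rightarrow> 'k::field) \<Rightarrow> ('k, (torus_gen word \<Rightarrow>\<^sub>0 'k) set) module" where
  "quantum_torus n \<Lambda> =
     presented_algebra (TY ` {1..n} \<union> TYinv ` {1..n})
       ({(gen (TY i) * gen (TYinv i), 1) | i. i \<in> {1..n}} \<union>
        {(gen (TYinv i) * gen (TY i), 1) | i. i \<in> {1..n}} \<union>
        {(gen (TY i) * gen (TY j), const (\<Lambda> i j) * gen (TY j) * gen (TY i))
          | i j. i \<in> {1..n} \<and> j \<in> {1..n}})"

lemma quantum_torus_k_algebra: "k_algebra (quantum_torus n \<Lambda>)"
  unfolding quantum_torus_def
proof (rule presented_algebra_k_algebra, goal_cases)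
  case (1 p q)
  then show ?case
    unfolding Un_iff free_algebra_simps mem_Collect_eq
    by (elim disjE exE conjE) (simp only: prod.inject, (elim conjE, hypsubst)?,
      intro conjI keys_word_intros; simp)+
qed

definition maximal_quantum_subtorus ::
  "nat \<Rightarrow> (nat \<Rightarrow> nat \<Rightarrow> 'k::field) \<Rightarrow> ('k, 'a) module \<Rightarrow> bool" where
  "maximal_quantum_subtorus n \<Lambda> A \<longleftrightarrow>
     (\<exists>B. is_subalgebra B A \<and> alg_iso (quantum_torus n \<Lambda>) (A\<lparr>carrier := B\<rparr>) \<noteq> {}) \<and>
     (\<forall>m M. 1 \<le> m \<and> mult_antisymmetric m M \<and> alg_hom (quantum_torus m M) A \<noteq> {} \<longrightarrow>
        alg_hom (quantum_torus m M) (quantum_torus n \<Lambda>) \<noteq> {})"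


section \<open>The algebras \<open>S\<close>\<close>

datatype s_gen = SY nat | SX nat

definition S_algebra ::
  "nat \<Rightarrow> nat \<Rightarrow> (nat \<Rightarrow> nat \<Rightarrow> 'k::field) \<Rightarrow> ('k, (s_gen word \<Rightarrow>\<^sub>0 'k) set) module" where
  "S_algebra n r \<Lambda> =
     presented_algebra (SY ` {1..n} \<union> SX ` {1..r})
       ({(gen (SY i) * gen (SY j), const (\<Lambda> i j) * gen (SY j) * gen (SY i))
          | i j. i \<in> {1..n} \<and> j \<in> {1..n}} \<union>
        {(gen (SX i) * gen (SY i), gen (SY i) * gen (SX i) + 1) | i. i \<in> {1..r}} \<union>
        {(gen (SX i) * gen (SY j), const (inverse (\<Lambda> i j)) * gen (SY j) * gen (SX i))
          | i j. i \<in> {1..r} \<and> j \<in> {1..n} \<and> i \<noteq> j} \<union>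
        {(gen (SX i) * gen (SX j), const (\<Lambda> i j) * gen (SX j) * gen (SX i))
          | i j. i \<in> {1..r} \<and> j \<in> {1..r}})"

lemma S_algebra_k_algebra:
  assumes "r \<le> n"
  shows "k_algebra (S_algebra n r \<Lambda>)"
  unfolding S_algebra_def
proof (rule presented_algebra_k_algebra, goal_cases)
  case (1 p q)
  then show ?case
    unfolding Un_iff free_algebra_simps mem_Collect_eq
    using assms
    by (elim disjE exE conjE) (simp only: prod.inject, (elim conjE, hypsubst)?,
      intro conjI keys_word_intros; simp)+
qed

end

theory Submission
  imports Defs "HOL-Library.Multiset_Order"
begin

text \<open>
  In \<open>S\<close> order the monomials in the generators by the multiset of their letters. A relation
  permutes two letters at the price of a scalar, up to the lower term \<open>1\<close> in
  \<open>x\<^sub>i y\<^sub>i = y\<^sub>i x\<^sub>i + 1\<close>, and the graded algebra is a quantum affine space in which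
  \<open>x\<^sub>i\<close> satisfies the same commutation relations as \<open>y\<^sub>i\<^sup>-\<^sup>1\<close>. Sending an element to its leading term
  and then \<open>x\<^sub>i\<close> to \<open>y\<^sub>i\<^sup>-\<^sup>1\<close> is therefore a multiplicative map from \<open>S - {0}\<close> to the units of
  the quantum torus; it extends to \<open>Frac S - {0}\<close> and is compatible with scalars, so it carries
  the invertible generators of any quantum torus mapping to \<open>Frac S\<close> to units of the given
  torus satisfying the same relations. Conversely the torus maps to \<open>Frac S\<close> through the
  \<open>y\<^sub>i\<close>, injectively since it is simple.
\<close>


section \<open>The universal property of presented algebras\<close>

text \<open>The leading term must be shown to be well defined. Two things can go wrong. First, a
  word might be a combination of lower ones; excluding this is the independence half of a
  Poincare-Birkhoff-Witt theorem. It is obtained from a representation: acting on the empty formal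
  monomial, a word produces its own multiset of letters with nonzero coefficient and otherwise only
  smaller ones. Second, one leading term is represented by many words, since words are never
  normalized. The scalar relating two such words in \<open>S\<close> modulo lower terms must then
  equal the scalar relating their images in the torus; this forces \<open>x_i\<close> to go to
  \<open>y_i^-1\<close>. Taking leading terms does not respect sums, so no algebra morphism from
  \<open>Frac S\<close> to the torus arises. It suffices because the relations of a quantum torus
  involve only products, inverses and scalars. No basis of the torus is ever computed. That the
  torus is not the zero ring is read off from its morphism to \<open>Frac S\<close>, and its ideals
  are studied through lifts to the free algebra.\<close>

context k_algebra
begin

lemma smult_cl [simp, intro]: "x \<in> carrier A \<Longrightarrow> c \<odot> x \<in> carrier A"
  by (rule smult_closed) (auto simp: ring_of_type_algebra_def)

lemma
  assumes "x \<in> carrier A"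
  shows smult_add_left: "(c + d) \<odot> x = c \<odot> x \<oplus> d \<odot> x"
    and smult_smult: "c \<odot> (d \<odot> x) = (c * d) \<odot> x"
    and smult_1 [simp]: "1 \<odot> x = x"
  using assms smult_l_distr[of c d x] smult_assoc1[of c d x] smult_one[of x]
  by (auto simp: ring_of_type_algebra_def)

lemma smult_add_right:
  "x \<in> carrier A \<Longrightarrow> y \<in> carrier A \<Longrightarrow> c \<odot> (x \<oplus> y) = c \<odot> x \<oplus> c \<odot> y"
  using smult_r_distr[of c x y] by (auto simp: ring_of_type_algebra_def)

lemma smult_0_left [simp]: "x \<in> carrier A \<Longrightarrow> 0 \<odot> x = \<zero>"
  using smult_l_null[of x] by (simp add: ring_of_type_algebra_def)

lemma smult_0_right [simp]: "c \<odot> \<zero> = \<zero>"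
  using smult_r_null[of c] by (simp add: ring_of_type_algebra_def)

lemma smult_cancel:
  assumes "c \<odot> x = c \<odot> y" "c \<noteq> 0" "x \<in> carrier A" "y \<in> carrier A"
  shows "x = y"
proof -
  have *: "z = inverse c \<odot> (c \<odot> z)" if "z \<in> carrier A" for z
    using that assms(2) by (simp add: smult_smult)
  show ?thesis
    using *[OF assms(3)] *[OF assms(4)] assms(1) by simp
qed

lemma smult_mult_smult:
  "x \<in> carrier A \<Longrightarrow> y \<in> carrier A \<Longrightarrow> (c \<odot> x) \<otimes> (d \<odot> y) = (c * d) \<odot> (x \<otimes> y)"
  by (simp add: smult_mult_left smult_mult_right smult_smult mult.commute)

lemma smult_Units:
  assumes "c \<noteq> 0" "u \<in> Units A"
  shows "c \<odot> u \<in> Units A"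
proof -
  have "(c \<odot> u) \<otimes> (inverse c \<odot> inv u) = \<one>" "(inverse c \<odot> inv u) \<otimes> (c \<odot> u) = \<one>"
    using assms by (simp_all add: smult_mult_smult Units_closed)
  moreover have "c \<odot> u \<in> carrier A" "inverse c \<odot> inv u \<in> carrier A"
    using assms by (auto intro: Units_closed)
  ultimately show ?thesis
    unfolding Units_def by blast
qed

section \<open>Evaluation of noncommutative polynomials in an algebra\<close>

definition word_value :: "('g \<Rightarrow> 'a) \<Rightarrow> 'g list \<Rightarrow> 'a" where
  "word_value v ws = foldr (\<lambda>g x. v g \<otimes> x) ws \<one>"

definition free_eval :: "('g \<Rightarrow> 'a) \<Rightarrow> ('g word \<Rightarrow>\<^sub>0 'k) \<Rightarrow> 'a" where
  "free_eval v p =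
     (\<Oplus>w\<in>Poly_Mapping.keys p. Poly_Mapping.lookup p w \<odot> word_value v (letters w))"

lemma word_value_simps [simp]:
  "word_value v [] = \<one>"
  "word_value v (g # ws) = v g \<otimes> word_value v ws"
  by (simp_all add: word_value_def)

lemma word_value_closed [simp]:
  "v \<in> G \<rightarrow> carrier A \<Longrightarrow> set ws \<subseteq> G \<Longrightarrow> word_value v ws \<in> carrier A"
  by (induction ws) auto

lemma word_value_append:
  "v \<in> G \<rightarrow> carrier A \<Longrightarrow> set us \<subseteq> G \<Longrightarrow> set ws \<subseteq> G \<Longrightarrow>
     word_value v (us @ ws) = word_value v us \<otimes> word_value v ws"
proof (induction us)
  case (Cons g us)
  then have "v g \<in> carrier A" "word_value v us \<in> carrier A" "word_value v ws \<in> carrier A"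
    by auto
  then show ?case
    using Cons by (simp add: m_assoc)
qed simp

end

definition mon :: "'g list \<Rightarrow> ('g word \<Rightarrow>\<^sub>0 'k::field)" where
  "mon ws = Poly_Mapping.single (Word ws) 1"

lemma mon_Nil [simp]: "mon [] = 1"
  by (simp add: mon_def flip: zero_word_def)

lemma mon_append: "mon (us @ ws) = mon us * mon ws"
  by (simp add: mon_def mult_single plus_word_def)

lemma gen_eq_mon: "gen g = mon [g]"
  by (simp add: mon_def gen_def)

lemma single_eq_mon: "Poly_Mapping.single w c = const c * mon (letters w)"
  by (simp add: mon_def const_def mult_single zero_word_def plus_word_def)

lemma keys_mon [simp]: "Poly_Mapping.keys (mon ws :: 'g word \<Rightarrow>\<^sub>0 'k::field) = {Word ws}"
  by (simp add: mon_def)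

lemma const_0 [simp]: "const 0 = 0"
  by (simp add: const_def)

lemma const_uminus: "const (- c) = - const c"
  by (simp add: const_def single_uminus)

lemma poly_mapping_span_induct [consumes 1, case_names zero single add]:
  assumes "Poly_Mapping.keys p \<subseteq> W" "P 0" "\<And>w c. w \<in> W \<Longrightarrow> P (Poly_Mapping.single w c)"
    and "\<And>p q. Poly_Mapping.keys p \<subseteq> W \<Longrightarrow> Poly_Mapping.keys q \<subseteq> W \<Longrightarrow> P p \<Longrightarrow> P q \<Longrightarrow> P (p + q)"
  shows "P p"
  using assms(1)
proof (induction p rule: update_induct)
  case const
  then show ?case using assms(2) by simp
next
  case (update f a b)
  have *: "Poly_Mapping.update a b f = f + Poly_Mapping.single a b"
    using update by (intro poly_mapping_eqI) (auto simp: lookup_update lookup_add lookup_single in_keys_iff when_def)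
  have "Poly_Mapping.keys (Poly_Mapping.update a b f) = insert a (Poly_Mapping.keys f)"
    using update by (auto simp: in_keys_iff lookup_update split: if_splits)
  then have "a \<in> W" "Poly_Mapping.keys f \<subseteq> W"
    using update by auto
  then show ?case
    unfolding * using update assms(3)[of a b] by (intro assms(4)) (auto split: if_splits)
qed

context k_algebra
begin

text \<open>Cancellation can shrink the support of a sum, so additivity compares all three
  evaluations over one common finite set of words.\<close>

lemma free_eval_superset:
  assumes "v \<in> G \<rightarrow> carrier A" "finite K" "Poly_Mapping.keys p \<subseteq> K" "\<forall>w\<in>K. set (letters w) \<subseteq> G"
  shows "free_eval v p = (\<Oplus>w\<in>K. Poly_Mapping.lookup p w \<odot> word_value v (letters w))"
  unfolding free_eval_def
  by (rule add.finprod_mono_neutral_cong_left)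
     (use assms in \<open>auto simp: in_keys_iff\<close>)

lemma free_eval_closed:
  assumes "v \<in> G \<rightarrow> carrier A" "p \<in> carrier (free_algebra G)"
  shows "free_eval v p \<in> carrier A"
  unfolding free_eval_def using assms by (intro finsum_closed) auto

lemma free_eval_add:
  assumes "v \<in> G \<rightarrow> carrier A" "p \<in> carrier (free_algebra G)" "q \<in> carrier (free_algebra G)"
  shows "free_eval v (p + q) = free_eval v p \<oplus> free_eval v q"
proof -
  let ?K = "Poly_Mapping.keys p \<union> Poly_Mapping.keys q"
  have K: "finite ?K" "\<forall>w\<in>?K. set (letters w) \<subseteq> G"
    using assms by auto
  let ?f = "\<lambda>p w. Poly_Mapping.lookup p w \<odot> word_value v (letters w)"
  have f: "?f p \<in> ?K \<rightarrow> carrier A" "?f q \<in> ?K \<rightarrow> carrier A"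
    using assms K by auto
  have "free_eval v (p + q) = (\<Oplus>w\<in>?K. ?f (p + q) w)"
    using assms K keys_add[of p q] by (intro free_eval_superset[where G = G]) auto
  also have "\<dots> = (\<Oplus>w\<in>?K. ?f p w \<oplus> ?f q w)"
    using assms K f by (intro finsum_cong') (auto simp: lookup_add smult_add_left Pi_def)
  also have "\<dots> = free_eval v p \<oplus> free_eval v q"
    using assms K f by (subst finsum_addf) (auto simp: free_eval_superset[where K = ?K and G = G])
  finally show ?thesis .
qed

lemma free_eval_0 [simp]: "free_eval v 0 = \<zero>"
  by (simp add: free_eval_def)

lemma free_eval_single:
  assumes "v \<in> G \<rightarrow> carrier A" "set (letters w) \<subseteq> G"
  shows "free_eval v (Poly_Mapping.single w c) = c \<odot> word_value v (letters w)"
  using assms by (subst free_eval_superset[where K = "{w}" and G = G]) (auto split: if_splits)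

lemma free_eval_mon:
  "v \<in> G \<rightarrow> carrier A \<Longrightarrow> set ws \<subseteq> G \<Longrightarrow> free_eval v (mon ws) = word_value v ws"
  by (simp add: mon_def free_eval_single)

text \<open>Both sides are additive in \<open>p\<close> and in \<open>q\<close>, which reduces the
  claim to scalar multiples of two words, where concatenation is
  \<open>word_value_append\<close>.\<close>

lemma free_eval_mult:
  fixes p q :: "'g word \<Rightarrow>\<^sub>0 'k"
  assumes v: "v \<in> G \<rightarrow> carrier A" and p: "p \<in> carrier (free_algebra G)"
    and q: "q \<in> carrier (free_algebra G)"
  shows "free_eval v (p * q) = free_eval v p \<otimes> free_eval v q"
proof -
  let ?W = "{w. set (letters w) \<subseteq> G}"
  have cl: "r \<in> carrier (free_algebra G)" if "Poly_Mapping.keys r \<subseteq> ?W" for r :: "'g word \<Rightarrow>\<^sub>0 'k"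
    using that by auto
  have cm: "r * s \<in> carrier (free_algebra G)"
    if "Poly_Mapping.keys r \<subseteq> ?W" "Poly_Mapping.keys s \<subseteq> ?W" for r s :: "'g word \<Rightarrow>\<^sub>0 'k"
    using that keys_mult_word[of r G s] by auto
  have "Poly_Mapping.keys p \<subseteq> ?W" "Poly_Mapping.keys q \<subseteq> ?W"
    using p q by auto
  then show "free_eval v (p * q) = free_eval v p \<otimes> free_eval v q"
  proof (induction p rule: poly_mapping_span_induct)
    case zero
    then show ?case using free_eval_closed[OF v q] by simp
  next
    case (single u c)
    from single(2,1) show ?case
    proof (induction q rule: poly_mapping_span_induct)
      case zero
      then show ?case using v by (simp add: free_eval_single)
    next
      case (single w d)
      then show ?case
        using v by (simp add: mult_single free_eval_single plus_word_def word_value_append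
          smult_mult_smult)
    next
      case (add q q')
      have u: "Poly_Mapping.keys (Poly_Mapping.single u c) \<subseteq> ?W"
        using add by (auto split: if_splits)
      have "free_eval v (q + q') = free_eval v q \<oplus> free_eval v q'"
        by (rule free_eval_add[OF v cl[OF add.hyps(1)] cl[OF add.hyps(2)]])
      moreover have "free_eval v (Poly_Mapping.single u c * q + Poly_Mapping.single u c * q') =
          free_eval v (Poly_Mapping.single u c * q) \<oplus> free_eval v (Poly_Mapping.single u c * q')"
        by (rule free_eval_add[OF v cm[OF u add.hyps(1)] cm[OF u add.hyps(2)]])
      ultimately show ?case
        using free_eval_closed[OF v cl[OF u]] free_eval_closed[OF v cl[OF add.hyps(1)]]
          free_eval_closed[OF v cl[OF add.hyps(2)]]
        by (simp only: distrib_left add.IH[OF add.prems] r_distr)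
    qed
  next
    case (add p p')
    have q': "Poly_Mapping.keys q \<subseteq> ?W"
      using q by auto
    have "free_eval v (p + p') = free_eval v p \<oplus> free_eval v p'"
      by (rule free_eval_add[OF v cl[OF add.hyps(1)] cl[OF add.hyps(2)]])
    moreover have "free_eval v (p * q + p' * q) = free_eval v (p * q) \<oplus> free_eval v (p' * q)"
      by (rule free_eval_add[OF v cm[OF add.hyps(1) q'] cm[OF add.hyps(2) q']])
    ultimately show ?case
      using free_eval_closed[OF v q] free_eval_closed[OF v cl[OF add.hyps(1)]]
        free_eval_closed[OF v cl[OF add.hyps(2)]]
      by (simp only: distrib_right add.IH[OF q'] l_distr)
  qed
qed

lemma free_eval_const:
  "free_eval v (const c) = c \<odot> \<one>"
  unfolding const_def by (subst free_eval_single[where G = "{}"]) (auto simp: zero_word_def)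

lemma free_eval_alg_hom:
  assumes v: "v \<in> G \<rightarrow> carrier A"
  shows "free_eval v \<in> alg_hom (free_algebra G) A"
proof -
  have "free_eval v 1 = \<one>"
    using free_eval_const[of v 1] by (simp add: const_simps)
  moreover have "free_eval v (const c * p) = c \<odot> free_eval v p" if "p \<in> carrier (free_algebra G)" for c p
    using free_eval_mult[OF v _ that, of "const c"] free_eval_closed[OF v that]
    by (simp add: keys_const_word free_eval_const smult_mult_left)
  ultimately show ?thesis
    using v free_eval_closed free_eval_mult free_eval_add
    by (auto simp: alg_hom_def intro!: ring_hom_memI simp del: free_algebra_simps(1))
qed

end

section \<open>Presented algebras and homomorphisms out of them\<close>

locale presentation =
  fixes G :: "'g set" and R :: "(('g word \<Rightarrow>\<^sub>0 'k::field) \<times> ('g word \<Rightarrow>\<^sub>0 'k)) set"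
  assumes relations_closed:
    "\<And>p q. (p, q) \<in> R \<Longrightarrow> p \<in> carrier (free_algebra G) \<and> q \<in> carrier (free_algebra G)"
begin

definition proj :: "('g word \<Rightarrow>\<^sub>0 'k) \<Rightarrow> ('g word \<Rightarrow>\<^sub>0 'k) set" where
  "proj p = relation_ideal G R +>\<^bsub>free_algebra G\<^esub> p"

abbreviation "FA \<equiv> free_algebra G :: ('k, 'g word \<Rightarrow>\<^sub>0 'k) module"
abbreviation "PA \<equiv> presented_algebra G R"

lemma relation_diff_closed: "{p - q | p q. (p, q) \<in> R} \<subseteq> carrier FA"
  using relations_closed keys_diff by fastforce

lemma ideal_relation_ideal: "ideal (relation_ideal G R) FA"
  unfolding relation_ideal_def
  by (intro ring.genideal_ideal free_algebra_ring relation_diff_closed)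

lemma PA_k_algebra: "k_algebra PA"
  by (rule presented_algebra_k_algebra) (rule relations_closed)

sublocale FA: k_algebra FA
  by (rule free_algebra_k_algebra)

sublocale PA: k_algebra PA
  by (rule PA_k_algebra)

sublocale RI: ideal "relation_ideal G R" FA
  by (rule ideal_relation_ideal)

lemma PA_carrier: "carrier PA = proj ` carrier FA"
  by (auto simp: presented_algebra_def FactRing_simps proj_def simp del: free_algebra_simps)

lemma proj_closed [simp]: "p \<in> carrier FA \<Longrightarrow> proj p \<in> carrier PA"
  by (simp add: PA_carrier del: free_algebra_simps)

lemma proj_alg_hom: "proj \<in> alg_hom FA PA"
proof -
  have "proj \<in> ring_hom FA PA"
    using RI.rcos_ring_hom
    by (auto simp: ring_hom_def presented_algebra_def proj_def[abs_def] simp del: free_algebra_simps)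
  moreover have "proj (c \<odot>\<^bsub>FA\<^esub> p) = c \<odot>\<^bsub>PA\<^esub> proj p" if "p \<in> carrier FA" for c p
    using FA.quotient_smult[OF ideal_relation_ideal that, of c]
    by (simp add: presented_algebra_def proj_def del: free_algebra_simps)
  ultimately show ?thesis
    by (simp add: alg_hom_def)
qed

lemma proj_mult:
    "p \<in> carrier FA \<Longrightarrow> q \<in> carrier FA \<Longrightarrow> proj (p * q) = proj p \<otimes>\<^bsub>PA\<^esub> proj q"
  and proj_add:
    "p \<in> carrier FA \<Longrightarrow> q \<in> carrier FA \<Longrightarrow> proj (p + q) = proj p \<oplus>\<^bsub>PA\<^esub> proj q"
  and proj_smult: "p \<in> carrier FA \<Longrightarrow> proj (const c * p) = c \<odot>\<^bsub>PA\<^esub> proj p"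
  using proj_alg_hom ring_hom_mult[of proj FA PA] ring_hom_add[of proj FA PA]
  by (auto simp: alg_hom_def simp del: free_algebra_simps(1))

lemma proj_1 [simp]: "proj 1 = \<one>\<^bsub>PA\<^esub>"
  using proj_alg_hom ring_hom_one[of proj FA PA] by (auto simp: alg_hom_def)

lemma proj_0 [simp]: "proj 0 = \<zero>\<^bsub>PA\<^esub>"
  using proj_smult[of 0 0] by simp

lemma proj_eq_iff:
  assumes "p \<in> carrier FA" "q \<in> carrier FA"
  shows "proj p = proj q \<longleftrightarrow> p - q \<in> relation_ideal G R"
proof -
  have "- q \<in> carrier FA"
    using assms by simp
  then have "\<ominus>\<^bsub>FA\<^esub> q = - q"
    using assms by (intro FA.minus_equality) simp_all
  then have "p - q = p \<ominus>\<^bsub>FA\<^esub> q"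
    by (simp add: a_minus_def)
  then show ?thesis
    using FA.quotient_eq_iff_same_a_r_cos[OF ideal_relation_ideal assms]
    unfolding proj_def by argo
qed

lemma proj_relation: "(p, q) \<in> R \<Longrightarrow> proj p = proj q"
  using relations_closed[of p q] relation_diff_closed
  by (subst proj_eq_iff)
     (auto simp: relation_ideal_def simp del: free_algebra_simps
       intro!: set_mp[OF ring.genideal_self[OF free_algebra_ring]])

text \<open>The kernel of evaluation is an ideal containing the differences of all relations, hence
  contains the relation ideal; so evaluation is constant on cosets.\<close>

lemma universal_property:
  fixes A :: "('k, 'a) module"
  assumes "k_algebra A" and v: "v \<in> G \<rightarrow> carrier A"
    and rel: "\<And>p q. (p, q) \<in> R \<Longrightarrow> k_algebra.free_eval A v p = k_algebra.free_eval A v q"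
  obtains h where "h \<in> alg_hom PA A"
    "\<And>p. p \<in> carrier FA \<Longrightarrow> h (proj p) = k_algebra.free_eval A v p"
proof -
  interpret A: k_algebra A by fact
  let ?e = "A.free_eval v"
  have e: "?e \<in> alg_hom FA A"
    using v by (rule A.free_eval_alg_hom)
  interpret e: ring_hom_ring FA A ?e
    using e by (intro ring_hom_ringI2 free_algebra_ring A.ring_axioms) (simp add: alg_hom_def)
  have diff: "?e (p - q) = \<zero>\<^bsub>A\<^esub> \<longleftrightarrow> ?e p = ?e q" if "p \<in> carrier FA" "q \<in> carrier FA" for p q
  proof -
    have pq: "p - q \<in> carrier FA"
      using that keys_diff[of p q] by fastforce
    have "?e p = ?e (p - q) \<oplus>\<^bsub>A\<^esub> ?e q"
      using A.free_eval_add[OF v pq that(2)] by simp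
    then show ?thesis
      using A.add.r_cancel_one[of "?e q" "?e (p - q)"] e.hom_closed[OF pq] e.hom_closed[OF that(2)]
      by argo
  qed
  have "p - q \<in> a_kernel FA A ?e" if "(p, q) \<in> R" for p q
  proof -
    have pq: "p \<in> carrier FA" "q \<in> carrier FA"
      using relations_closed[OF that] by blast+
    have "p - q \<in> carrier FA"
      using relation_diff_closed that by blast
    then show ?thesis
      unfolding a_kernel_def' using diff[OF pq] rel[OF that] by blast
  qed
  then have "relation_ideal G R \<subseteq> a_kernel FA A ?e"
    unfolding relation_ideal_def by (intro FA.genideal_minimal e.kernel_is_ideal) blast
  then have well: "?e p = ?e q" if "p \<in> carrier FA" "q \<in> carrier FA" "proj p = proj q" for p q
    using that(3) diff[OF that(1,2)] unfolding proj_eq_iff[OF that(1,2)] a_kernel_def' by blast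
  \<comment> \<open>Any representative of the coset may be evaluated, by \<open>well\<close>; the
    choice only turns this into a function.\<close>
  define h where "h C = ?e (SOME p. p \<in> carrier FA \<and> proj p = C)" for C
  have h: "h (proj p) = ?e p" if "p \<in> carrier FA" for p
    unfolding h_def by (rule someI2[where a = p]) (use that in \<open>blast intro: well\<close>)+
  have "h \<in> ring_hom PA A"
  proof (rule ring_hom_memI)
    show "h \<one>\<^bsub>PA\<^esub> = \<one>\<^bsub>A\<^esub>"
      using h[OF FA.one_closed] e.hom_one by (simp only: proj_1 free_algebra_simps)
    fix x y assume "x \<in> carrier PA" "y \<in> carrier PA"
    then obtain p q where p: "x = proj p" "p \<in> carrier FA" and q: "y = proj q" "q \<in> carrier FA"
      unfolding PA_carrier by blast
    show "h x \<in> carrier A"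
      unfolding p(1) h[OF p(2)] by (rule e.hom_closed[OF p(2)])
    have pq: "p * q \<in> carrier FA" "p + q \<in> carrier FA"
      using FA.m_closed[OF p(2) q(2)] FA.a_closed[OF p(2) q(2)]
      by (simp_all only: free_algebra_simps(2,5))
    show "h (x \<otimes>\<^bsub>PA\<^esub> y) = h x \<otimes>\<^bsub>A\<^esub> h y"
      using e.hom_mult[OF p(2) q(2)]
      by (simp only: p q flip: proj_mult proj_add) (simp only: h p q pq free_algebra_simps(2))
    show "h (x \<oplus>\<^bsub>PA\<^esub> y) = h x \<oplus>\<^bsub>A\<^esub> h y"
      using e.hom_add[OF p(2) q(2)]
      by (simp only: p q flip: proj_mult proj_add) (simp only: h p q pq free_algebra_simps(5))
  qed
  moreover have "h (c \<odot>\<^bsub>PA\<^esub> x) = c \<odot>\<^bsub>A\<^esub> h x" if x: "x \<in> carrier PA" for c x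
  proof -
    obtain p where p: "x = proj p" "p \<in> carrier FA"
      using x unfolding PA_carrier by blast
    have cp: "const c * p \<in> carrier FA"
      using FA.smult_cl[OF p(2), of c] by (simp only: free_algebra_simps(6))
    have "?e (const c * p) = c \<odot>\<^bsub>A\<^esub> ?e p"
      using e p(2) by (simp add: alg_hom_def del: free_algebra_simps(1))
    then show ?thesis
      by (simp only: p flip: proj_smult[OF p(2)]) (simp only: h p cp)
  qed
  ultimately have "h \<in> alg_hom PA A"
    by (simp add: alg_hom_def)
  then show ?thesis
    using h that by blast
qed

end



declare free_algebra_simps(1) [simp del]

context presentation
begin

lemma closed_FA [simp, intro]:
  "p \<in> carrier FA \<Longrightarrow> q \<in> carrier FA \<Longrightarrow> p * q \<in> carrier FA"
  "p \<in> carrier FA \<Longrightarrow> q \<in> carrier FA \<Longrightarrow> p + q \<in> carrier FA"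
  "const c \<in> carrier FA"
  "1 \<in> carrier FA" "0 \<in> carrier FA"
  "set ws \<subseteq> G \<Longrightarrow> mon ws \<in> carrier FA"
proof -
  show "p \<in> carrier FA \<Longrightarrow> q \<in> carrier FA \<Longrightarrow> p * q \<in> carrier FA"
    using FA.m_closed[of p q] by simp
  show "p \<in> carrier FA \<Longrightarrow> q \<in> carrier FA \<Longrightarrow> p + q \<in> carrier FA"
    using FA.a_closed[of p q] by simp
  show "const c \<in> carrier FA"
    unfolding free_algebra_simps(1) mem_Collect_eq by (rule keys_const_word)
  show "1 \<in> carrier FA" "0 \<in> carrier FA"
    using FA.one_closed FA.zero_closed by simp_all
  show "set ws \<subseteq> G \<Longrightarrow> mon ws \<in> carrier FA"
    by (simp add: free_algebra_simps(1))
qed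

lemma carrier_FA_iff: "p \<in> carrier FA \<longleftrightarrow> Poly_Mapping.keys p \<subseteq> {w. set (letters w) \<subseteq> G}"
  by (auto simp: free_algebra_simps(1))

lemma FA_induct [consumes 1, case_names zero single add]:
  assumes "p \<in> carrier FA" "P 0" "\<And>ws c. set ws \<subseteq> G \<Longrightarrow> P (const c * mon ws)"
    and "\<And>p q. p \<in> carrier FA \<Longrightarrow> q \<in> carrier FA \<Longrightarrow> P p \<Longrightarrow> P q \<Longrightarrow> P (p + q)"
  shows "P p"
  using assms(1) unfolding carrier_FA_iff
proof (induction p rule: poly_mapping_span_induct)
  case (single w c)
  then show ?case
    using assms(3)[of "letters w" c] by (simp add: single_eq_mon)
next
  case (add p q)
  then show ?case
    using assms(4)[of p q] unfolding carrier_FA_iff by blast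
qed (rule assms(2))

definition word :: "'g list \<Rightarrow> ('g word \<Rightarrow>\<^sub>0 'k) set" where
  "word ws = proj (mon ws)"

lemma word_closed [simp, intro]: "set ws \<subseteq> G \<Longrightarrow> word ws \<in> carrier PA"
  by (simp add: word_def)

lemma word_Nil [simp]: "word [] = \<one>\<^bsub>PA\<^esub>"
  by (simp add: word_def)

lemma word_append:
  "set us \<subseteq> G \<Longrightarrow> set ws \<subseteq> G \<Longrightarrow> word (us @ ws) = word us \<otimes>\<^bsub>PA\<^esub> word ws"
  by (simp add: word_def mon_append proj_mult)

lemma word_Cons:
  "g \<in> G \<Longrightarrow> set ws \<subseteq> G \<Longrightarrow> word (g # ws) = word [g] \<otimes>\<^bsub>PA\<^esub> word ws"
  using word_append[of "[g]" ws] by simp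

end

section \<open>Quantum tori\<close>

definition torus_relations ::
  "nat \<Rightarrow> (nat \<Rightarrow> nat \<Rightarrow> 'k::field) \<Rightarrow> ((torus_gen word \<Rightarrow>\<^sub>0 'k) \<times> (torus_gen word \<Rightarrow>\<^sub>0 'k)) set" where
  "torus_relations n \<Lambda> =
     {(gen (TY i) * gen (TYinv i), 1) | i. i \<in> {1..n}} \<union>
     {(gen (TYinv i) * gen (TY i), 1) | i. i \<in> {1..n}} \<union>
     {(gen (TY i) * gen (TY j), const (\<Lambda> i j) * gen (TY j) * gen (TY i))
       | i j. i \<in> {1..n} \<and> j \<in> {1..n}}"

definition torus_gens :: "nat \<Rightarrow> torus_gen set" where
  "torus_gens n = TY ` {1..n} \<union> TYinv ` {1..n}"

lemma torus_gens_iff [simp]: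
  "TY i \<in> torus_gens n \<longleftrightarrow> i \<in> {1..n}" "TYinv i \<in> torus_gens n \<longleftrightarrow> i \<in> {1..n}"
  by (auto simp: torus_gens_def)

lemma quantum_torus_eq:
  "quantum_torus n \<Lambda> = presented_algebra (torus_gens n) (torus_relations n \<Lambda>)"
  by (simp add: quantum_torus_def torus_relations_def torus_gens_def)

lemma torus_presentation: "presentation (torus_gens n) (torus_relations n \<Lambda>)"
proof (rule presentation.intro, goal_cases)
  case (1 p q)
  then show ?case
    unfolding torus_relations_def torus_gens_def Un_iff free_algebra_simps mem_Collect_eq
    by (elim disjE exE conjE) (simp only: prod.inject, (elim conjE, hypsubst)?,
      intro conjI keys_word_intros; simp)+
qed

text \<open>The letters \<open>TYinv i\<close> are sent to the inverses of the \<open>u i\<close>,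
  so the cancellation relations are automatic and only the commutation relations have to be
  supplied.\<close>

lemma ex_torus_hom:
  fixes A :: "('k::field, 'a) module"
  assumes A: "k_algebra A" and u: "\<And>i. i \<in> {1..n} \<Longrightarrow> u i \<in> Units A"
    and rel: "\<And>i j. i \<in> {1..n} \<Longrightarrow> j \<in> {1..n} \<Longrightarrow>
      u i \<otimes>\<^bsub>A\<^esub> u j = \<Lambda> i j \<odot>\<^bsub>A\<^esub> (u j \<otimes>\<^bsub>A\<^esub> u i)"
  shows "\<exists>h. h \<in> alg_hom (quantum_torus n \<Lambda>) A"
proof -
  interpret A: k_algebra A by fact
  interpret presentation "torus_gens n" "torus_relations n \<Lambda>"
    by (rule torus_presentation)
  define v where "v g = (case g of TY i \<Rightarrow> u i | TYinv i \<Rightarrow> inv\<^bsub>A\<^esub> (u i))" for g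
  have v: "v \<in> torus_gens n \<rightarrow> carrier A"
    using u A.Units_closed[OF u] by (auto simp: v_def torus_gens_def)
  have cl: "v g \<in> carrier A" if "g \<in> torus_gens n" for g
    using v that by blast
  have [simp]: "A.free_eval v (gen g) = v g" if "g \<in> torus_gens n" for g
    unfolding gen_eq_mon using that cl[OF that] by (subst A.free_eval_mon[OF v]) simp_all
  have [simp]: "gen g \<in> carrier FA" if "g \<in> torus_gens n" for g
    unfolding gen_eq_mon using that by simp
  have [simp]: "A.free_eval v 1 = \<one>\<^bsub>A\<^esub>"
    using A.free_eval_mon[OF v, of "[]"] by simp
  have "A.free_eval v p = A.free_eval v q" if pq: "(p, q) \<in> torus_relations n \<Lambda>" for p q
  proof -
    consider i where "i \<in> {1..n}" "p = gen (TY i) * gen (TYinv i)" "q = 1"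
      | i where "i \<in> {1..n}" "p = gen (TYinv i) * gen (TY i)" "q = 1"
      | i j where "i \<in> {1..n}" "j \<in> {1..n}" "p = gen (TY i) * gen (TY j)"
          "q = const (\<Lambda> i j) * gen (TY j) * gen (TY i)"
      using pq unfolding torus_relations_def by blast
    then show ?thesis
    proof cases
      case 1
      then show ?thesis
        using u[OF 1(1)] by (simp add: A.free_eval_mult[OF v] v_def)
    next
      case 2
      then show ?thesis
        using u[OF 2(1)] by (simp add: A.free_eval_mult[OF v] v_def)
    next
      case 3
      then show ?thesis
        using rel[OF 3(1,2)] A.Units_closed[OF u[OF 3(1)]] A.Units_closed[OF u[OF 3(2)]]
        by (simp add: A.free_eval_mult[OF v] A.free_eval_const v_def A.smult_mult_left)
    qed
  qed
  then obtain h where "h \<in> alg_hom PA A"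
    using universal_property[OF A v] by blast
  then show ?thesis
    by (auto simp: quantum_torus_eq)
qed

locale torus =
  fixes n :: nat and \<Lambda> :: "nat \<Rightarrow> nat \<Rightarrow> 'k::field"
  assumes antisym: "mult_antisymmetric n \<Lambda>"
begin

sublocale presentation "torus_gens n" "torus_relations n \<Lambda>"
  by (rule torus_presentation)

abbreviation "T \<equiv> quantum_torus n \<Lambda>"

lemma PA_eq: "PA = T"
  by (simp add: quantum_torus_eq)

lemma Lambda:
  assumes "i \<in> {1..n}" "j \<in> {1..n}"
  shows "\<Lambda> i j \<noteq> 0" "\<Lambda> i i = 1" "inverse (\<Lambda> i j) = \<Lambda> j i"
proof -
  have *: "\<Lambda> i j \<noteq> 0" "\<Lambda> i i = 1" "\<Lambda> i j * \<Lambda> j i = 1"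
    using antisym[unfolded mult_antisymmetric_def, rule_format, OF assms] by simp_all
  then show "\<Lambda> i j \<noteq> 0" "\<Lambda> i i = 1" "inverse (\<Lambda> i j) = \<Lambda> j i"
    by (simp_all add: inverse_unique)
qed

fun inv_gen :: "torus_gen \<Rightarrow> torus_gen" where
  "inv_gen (TY i) = TYinv i"
| "inv_gen (TYinv i) = TY i"

fun gen_index :: "torus_gen \<Rightarrow> nat" where
  "gen_index (TY i) = i"
| "gen_index (TYinv i) = i"

fun gen_sign :: "torus_gen \<Rightarrow> int" where
  "gen_sign (TY i) = 1"
| "gen_sign (TYinv i) = - 1"

lemma inv_gen_closed [simp]: "inv_gen g \<in> torus_gens n \<longleftrightarrow> g \<in> torus_gens n"
  by (cases g) auto

lemma gen_index_range: "g \<in> torus_gens n \<Longrightarrow> gen_index g \<in> {1..n}"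
  by (cases g) auto

lemma word_inv_gen:
  assumes "g \<in> torus_gens n"
  shows "word [g, inv_gen g] = \<one>\<^bsub>T\<^esub>"
proof -
  have "(gen g * gen (inv_gen g), 1) \<in> torus_relations n \<Lambda>"
    using assms by (cases g) (auto simp: torus_relations_def)
  from proj_relation[OF this] show ?thesis
    by (simp add: word_def gen_eq_mon PA_eq flip: mon_append)
qed

lemma word_gen_Units:
  assumes "g \<in> torus_gens n"
  shows "word [g] \<in> Units T" "inv\<^bsub>T\<^esub> (word [g]) = word [inv_gen g]"
proof -
  have "inv_gen (inv_gen g) = g"
    by (cases g) auto
  then have *: "word [g] \<otimes>\<^bsub>T\<^esub> word [inv_gen g] = \<one>\<^bsub>T\<^esub>"
      "word [inv_gen g] \<otimes>\<^bsub>T\<^esub> word [g] = \<one>\<^bsub>T\<^esub>"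
    using assms word_inv_gen[of g] word_inv_gen[of "inv_gen g"] word_Cons[of g "[inv_gen g]"]
      word_Cons[of "inv_gen g" "[g]"]
    by (auto simp: PA_eq)
  moreover have "word [g] \<in> carrier T" "word [inv_gen g] \<in> carrier T"
    using assms word_closed[of "[g]"] word_closed[of "[inv_gen g]"] by (simp_all add: PA_eq del: word_closed)
  ultimately show "word [g] \<in> Units T" "inv\<^bsub>T\<^esub> (word [g]) = word [inv_gen g]"
    using PA.inv_char[of "word [g]" "word [inv_gen g]"] by (auto simp: Units_def PA_eq)
qed


section \<open>Commutation of words in the torus up to scalars\<close>

definition comm_factor :: "torus_gen \<Rightarrow> torus_gen \<Rightarrow> 'k" where
  "comm_factor g h = \<Lambda> (gen_index g) (gen_index h) powi (gen_sign g * gen_sign h)"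

lemma comm_factor_nonzero: "g \<in> torus_gens n \<Longrightarrow> h \<in> torus_gens n \<Longrightarrow> comm_factor g h \<noteq> 0"
  using Lambda(1)[of "gen_index g" "gen_index h"] gen_index_range by (simp add: comm_factor_def)

lemma word_Units:
  "set ws \<subseteq> torus_gens n \<Longrightarrow> word ws \<in> Units T"
proof (induction ws)
  case (Cons g ws)
  then show ?case
    using word_gen_Units(1)[of g] word_Cons[of g ws] PA.Units_m_closed[of "word [g]" "word ws"]
    by (simp add: PA_eq)
qed (use PA.Units_one_closed in \<open>simp add: PA_eq\<close>)

end

context k_algebra
begin

lemma commute_inverse_right:
  assumes "u \<in> Units A" "x \<in> carrier A" "c \<noteq> 0" "u \<otimes> x = c \<odot> (x \<otimes> u)"
  shows "inv u \<otimes> x = inverse c \<odot> (x \<otimes> inv u)"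
proof -
  have [simp]: "u \<in> carrier A" "inv u \<in> carrier A"
    using assms by auto
  have "inv u \<otimes> (u \<otimes> x) \<otimes> inv u = x \<otimes> inv u"
    using assms(1,2) by (simp flip: m_assoc)
  moreover have "inv u \<otimes> (c \<odot> (x \<otimes> u)) \<otimes> inv u = c \<odot> (inv u \<otimes> x)"
    using assms(1,2) by (simp add: smult_mult_left smult_mult_right m_assoc)
  ultimately have "x \<otimes> inv u = c \<odot> (inv u \<otimes> x)"
    unfolding assms(4) by simp
  then show ?thesis
    using assms(2,3) by (simp add: smult_smult)
qed

lemma commute_inverse_left:
  assumes "u \<in> Units A" "x \<in> carrier A" "c \<noteq> 0" "x \<otimes> u = c \<odot> (u \<otimes> x)"
  shows "x \<otimes> inv u = inverse c \<odot> (inv u \<otimes> x)"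
proof -
  have [simp]: "u \<in> carrier A" "inv u \<in> carrier A"
    using assms by auto
  have "inv u \<otimes> (x \<otimes> u) \<otimes> inv u = inv u \<otimes> x"
    using assms(1,2) by (simp add: m_assoc)
  moreover have "inv u \<otimes> (c \<odot> (u \<otimes> x)) \<otimes> inv u = c \<odot> (x \<otimes> inv u)"
    using assms(1,2) by (simp add: smult_mult_left smult_mult_right flip: m_assoc)
  ultimately have "inv u \<otimes> x = c \<odot> (x \<otimes> inv u)"
    unfolding assms(4) by simp
  then show ?thesis
    using assms(2,3) by (simp add: smult_smult)
qed

end

context torus
begin

text \<open>Only pairs of \<open>TY\<close> letters are given by relations. Passing to the inverse
  of either letter inverts the scalar, which yields the other three cases and explains the product
  of signs in \<open>comm_factor\<close>.\<close>

lemma word_gens_commute: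
  assumes "g \<in> torus_gens n" "h \<in> torus_gens n"
  shows "word [g] \<otimes>\<^bsub>T\<^esub> word [h] = comm_factor g h \<odot>\<^bsub>T\<^esub> (word [h] \<otimes>\<^bsub>T\<^esub> word [g])"
proof -
  have base: "word [TY i] \<otimes>\<^bsub>T\<^esub> word [TY j] = \<Lambda> i j \<odot>\<^bsub>T\<^esub> (word [TY j] \<otimes>\<^bsub>T\<^esub> word [TY i])"
    if "i \<in> {1..n}" "j \<in> {1..n}" for i j
  proof -
    have "(mon [TY i] * mon [TY j], const (\<Lambda> i j) * (mon [TY j] * mon [TY i])) \<in> torus_relations n \<Lambda>"
      using that by (auto simp: torus_relations_def gen_eq_mon mult.assoc)
    from proj_relation[OF this] show ?thesis
      using that by (simp add: word_def proj_smult PA_eq) (simp add: proj_mult PA_eq)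
  qed
  have U: "word [TY i] \<in> Units T" "inv\<^bsub>T\<^esub> word [TY i] = word [TYinv i]"
      "word [TY i] \<in> carrier T" "word [TYinv i] \<in> carrier T" "\<Lambda> i j \<noteq> 0"
    if "i \<in> {1..n}" "j \<in> {1..n}" for i j
    using that word_gen_Units[of "TY i"] word_closed[of "[TY i]"] word_closed[of "[TYinv i]"]
      Lambda(1)[of i j]
    by (simp_all add: PA_eq)
  have inv1: "word [TYinv i] \<otimes>\<^bsub>T\<^esub> word [TY j] = inverse (\<Lambda> i j) \<odot>\<^bsub>T\<^esub> (word [TY j] \<otimes>\<^bsub>T\<^esub> word [TYinv i])"
    if "i \<in> {1..n}" "j \<in> {1..n}" for i j
    using PA.commute_inverse_right[of "word [TY i]" "word [TY j]" "\<Lambda> i j"] that U[OF that] U[OF that(2,1)] base[OF that]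
    by (simp add: PA_eq)
  have inv2: "word [TY i] \<otimes>\<^bsub>T\<^esub> word [TYinv j] = inverse (\<Lambda> i j) \<odot>\<^bsub>T\<^esub> (word [TYinv j] \<otimes>\<^bsub>T\<^esub> word [TY i])"
    if "i \<in> {1..n}" "j \<in> {1..n}" for i j
    using PA.commute_inverse_left[of "word [TY j]" "word [TY i]" "\<Lambda> i j"] that U[OF that] U[OF that(2,1)] base[OF that]
    by (simp add: PA_eq)
  have inv3: "word [TYinv i] \<otimes>\<^bsub>T\<^esub> word [TYinv j] = \<Lambda> i j \<odot>\<^bsub>T\<^esub> (word [TYinv j] \<otimes>\<^bsub>T\<^esub> word [TYinv i])"
    if "i \<in> {1..n}" "j \<in> {1..n}" for i j
    using PA.commute_inverse_left[of "word [TY j]" "word [TYinv i]" "inverse (\<Lambda> i j)"] that U[OF that] U[OF that(2,1)] inv1[OF that]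
    by (simp add: PA_eq)
  show ?thesis
    using assms
    by (cases g; cases h)
       (auto simp: comm_factor_def power_int_minus intro!: base inv1 inv2 inv3)
qed

fun word_factor :: "torus_gen \<Rightarrow> torus_gen list \<Rightarrow> 'k" where
  "word_factor g [] = 1"
| "word_factor g (h # ws) = comm_factor g h * word_factor g ws"

lemma word_factor_nonzero:
  "g \<in> torus_gens n \<Longrightarrow> set ws \<subseteq> torus_gens n \<Longrightarrow> word_factor g ws \<noteq> 0"
  by (induction ws) (auto simp: comm_factor_nonzero)

lemma word_factor_commute:
  assumes g: "g \<in> torus_gens n"
  shows "set ws \<subseteq> torus_gens n \<Longrightarrow>
    word [g] \<otimes>\<^bsub>T\<^esub> word ws = word_factor g ws \<odot>\<^bsub>T\<^esub> (word ws \<otimes>\<^bsub>T\<^esub> word [g])"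
proof (induction ws)
  case Nil
  then show ?case
    using PA.l_one[of "word [g]"] PA.r_one[of "word [g]"] PA.smult_1[of "word [g]"] g
      word_closed[of "[g]"]
    by (simp add: PA_eq)
next
  case (Cons h ws)
  have cl: "word [g] \<in> carrier PA" "word [h] \<in> carrier PA" "word ws \<in> carrier PA"
    using Cons g by auto
  have "word [g] \<otimes>\<^bsub>PA\<^esub> word (h # ws) = (word [g] \<otimes>\<^bsub>PA\<^esub> word [h]) \<otimes>\<^bsub>PA\<^esub> word ws"
    using Cons cl by (simp add: word_Cons[of h ws] PA.m_assoc)
  also have "\<dots> = comm_factor g h \<odot>\<^bsub>PA\<^esub> (word [h] \<otimes>\<^bsub>PA\<^esub> (word [g] \<otimes>\<^bsub>PA\<^esub> word ws))"
    using word_gens_commute[OF g, of h] Cons cl by (simp add: PA_eq[symmetric] PA.smult_mult_left PA.m_assoc)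
  also have "word [g] \<otimes>\<^bsub>PA\<^esub> word ws = word_factor g ws \<odot>\<^bsub>PA\<^esub> (word ws \<otimes>\<^bsub>PA\<^esub> word [g])"
    using Cons by (simp add: PA_eq)
  also have "comm_factor g h \<odot>\<^bsub>PA\<^esub> (word [h] \<otimes>\<^bsub>PA\<^esub> (word_factor g ws \<odot>\<^bsub>PA\<^esub> (word ws \<otimes>\<^bsub>PA\<^esub> word [g])))
      = word_factor g (h # ws) \<odot>\<^bsub>PA\<^esub> (word (h # ws) \<otimes>\<^bsub>PA\<^esub> word [g])"
    using Cons cl by (simp add: PA.smult_mult_right PA.smult_smult PA.m_assoc word_Cons[of h ws])
  finally show ?case
    by (simp add: PA_eq)
qed


section \<open>Exponent vectors of words in the torus\<close>

definition expo :: "torus_gen list \<Rightarrow> nat \<Rightarrow> int" where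
  "expo ws i = (\<Sum>g\<leftarrow>ws. if gen_index g = i then gen_sign g else 0)"

lemma expo_simps [simp]:
  "expo [] i = 0"
  "expo (g # ws) i = (if gen_index g = i then gen_sign g else 0) + expo ws i"
  "expo (us @ ws) i = expo us i + expo ws i"
  by (simp_all add: expo_def)

lemma gen_inv_gen [simp]: "gen_index (inv_gen g) = gen_index g" "gen_sign (inv_gen g) = - gen_sign g"
  by (cases g; simp)+

lemma expo_map_inv_gen [simp]: "expo (rev (map inv_gen ws)) i = - expo ws i"
  by (induction ws) auto

text \<open>Opposite letters of the same index contribute inverse scalars, so only the net exponents
  survive. This links commutation in the torus with the arithmetic condition on
  \<open>\<Lambda>\<close>.\<close>

lemma word_factor_eq:
  assumes "j \<in> {1..n}"
  shows "set ws \<subseteq> torus_gens n \<Longrightarrow> word_factor (TY j) ws = (\<Prod>i=1..n. \<Lambda> j i powi expo ws i)"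
proof (induction ws)
  case (Cons h ws)
  have h: "gen_index h \<in> {1..n}"
    using Cons gen_index_range by simp
  have "(\<Prod>i=1..n. \<Lambda> j i powi expo (h # ws) i) =
      (\<Prod>i=1..n. \<Lambda> j i powi (if gen_index h = i then gen_sign h else 0) * \<Lambda> j i powi expo ws i)"
    using assms Lambda(1) by (intro prod.cong) (auto simp: power_int_add)
  also have "\<dots> = (\<Prod>i=1..n. if i = gen_index h then \<Lambda> j i powi gen_sign h else 1) * word_factor (TY j) ws"
  proof -
    have "\<Lambda> j i powi (if gen_index h = i then gen_sign h else 0) =
        (if i = gen_index h then \<Lambda> j i powi gen_sign h else 1)" for i
      by simp
    then show ?thesis
      using Cons by (simp only: prod.distrib) simp
  qed
  also have "(\<Prod>i=1..n. if i = gen_index h then \<Lambda> j i powi gen_sign h else 1) = comm_factor (TY j) h"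
    using h by (subst prod.delta) (auto simp: comm_factor_def)
  finally show ?case
    by simp
qed simp

text \<open>The inverse of the first letter must occur further right. The first letter is moved up
  to it at the price of a scalar, the two cancel, and the shorter remaining word still has exponents
  zero.\<close>

lemma word_expo_zero:
  "set ws \<subseteq> torus_gens n \<Longrightarrow> \<forall>i. expo ws i = 0 \<Longrightarrow> \<exists>c. word ws = c \<odot>\<^bsub>T\<^esub> \<one>\<^bsub>T\<^esub>"
proof (induction ws rule: length_induct)
  case (1 ws)
  show ?case
  proof (cases ws)
    case Nil
    then show ?thesis
      using PA.smult_1[OF PA.one_closed] by (intro exI[of _ 1]) (simp add: PA_eq)
  next
    case (Cons g us)
    have "inv_gen g \<in> set us"
    proof (rule ccontr)
      assume *: "inv_gen g \<notin> set us"
      \<comment> \<open>Without \<open>inv_gen g\<close>, every letter of this index in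
        \<open>us\<close> has the sign of \<open>g\<close>; then nothing can compensate the
        contribution of \<open>g\<close> itself.\<close>
      have "gen_sign g * (if gen_index h = gen_index g then gen_sign h else 0) \<ge> 0" if "h \<in> set us" for h
        using * that by (cases g; cases h) auto
      then have "gen_sign g * expo us (gen_index g) \<ge> 0"
        unfolding expo_def sum_list_const_mult[symmetric] by (intro sum_list_nonneg) auto
      moreover have "expo us (gen_index g) = - gen_sign g"
        using 1(3)[rule_format, of "gen_index g"] Cons by simp
      ultimately show False
        by (cases g) auto
    qed
    then obtain as bs where us: "us = as @ inv_gen g # bs"
      by (meson split_list)
    have g: "g \<in> torus_gens n" "set as \<subseteq> torus_gens n" "set bs \<subseteq> torus_gens n"
      using 1(2) Cons us by auto
    have cl: "word as \<in> carrier PA" "word bs \<in> carrier PA" "word [g] \<in> carrier PA" "word [inv_gen g] \<in> carrier PA"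
      using g by auto
    have "word ws = word [g] \<otimes>\<^bsub>PA\<^esub> word as \<otimes>\<^bsub>PA\<^esub> word [inv_gen g] \<otimes>\<^bsub>PA\<^esub> word bs"
      using word_append[of "[g]" "as @ [inv_gen g] @ bs"] word_append[of "as" "[inv_gen g] @ bs"]
        word_append[of "[inv_gen g]" bs] g cl
      by (simp add: Cons us PA.m_assoc)
    also have "word [g] \<otimes>\<^bsub>PA\<^esub> word as = word_factor g as \<odot>\<^bsub>PA\<^esub> (word as \<otimes>\<^bsub>PA\<^esub> word [g])"
      using word_factor_commute[of g as] g by (simp add: PA_eq)
    also have "\<dots> \<otimes>\<^bsub>PA\<^esub> word [inv_gen g] \<otimes>\<^bsub>PA\<^esub> word bs =
        word_factor g as \<odot>\<^bsub>PA\<^esub> (word as \<otimes>\<^bsub>PA\<^esub> (word [g] \<otimes>\<^bsub>PA\<^esub> word [inv_gen g]) \<otimes>\<^bsub>PA\<^esub> word bs)"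
      using cl by (simp add: PA.smult_mult_left PA.m_assoc)
    also have "word [g] \<otimes>\<^bsub>PA\<^esub> word [inv_gen g] = \<one>\<^bsub>PA\<^esub>"
      using word_inv_gen[OF g(1)] word_append[of "[g]" "[inv_gen g]"] g by (simp add: PA_eq)
    also have "word as \<otimes>\<^bsub>PA\<^esub> \<one>\<^bsub>PA\<^esub> \<otimes>\<^bsub>PA\<^esub> word bs = word (as @ bs)"
      using g cl by (simp add: word_append)
    finally have ws: "word ws = word_factor g as \<odot>\<^bsub>T\<^esub> word (as @ bs)"
      by (simp add: PA_eq)
    have "\<forall>i. expo (as @ bs) i = 0"
    proof
      show "expo (as @ bs) i = 0" for i
        using 1(3)[rule_format, of i] by (simp add: Cons us split: if_splits)
    qed
    then obtain c where "word (as @ bs) = c \<odot>\<^bsub>T\<^esub> \<one>\<^bsub>T\<^esub>"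
      using 1(1)[rule_format, of "as @ bs"] g by (auto simp: Cons us)
    then show ?thesis
      using ws PA.smult_smult[OF PA.one_closed] by (auto simp: PA_eq)
  qed
qed

text \<open>With \<open>?us'\<close> the formal inverse of \<open>us\<close>, both
  \<open>ws @ ?us'\<close> and \<open>?us' @ us\<close> have exponents zero and are scalars
  \<open>c\<close> and \<open>d\<close>. Associativity of the triple product compares
  \<open>ws\<close> with \<open>us\<close>.\<close>

lemma word_expo_eq:
  assumes ws: "set ws \<subseteq> torus_gens n" and us: "set us \<subseteq> torus_gens n"
    and eq: "\<And>i. expo ws i = expo us i"
  shows "\<exists>c. word ws = c \<odot>\<^bsub>T\<^esub> word us"
proof -
  let ?us' = "rev (map inv_gen us)"
  have us': "set ?us' \<subseteq> torus_gens n"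
    using us by auto
  have cl: "word ws \<in> carrier PA" "word us \<in> carrier PA" "word ?us' \<in> carrier PA"
    using us us' ws by blast+
  have "\<forall>i. expo (ws @ ?us') i = 0" "\<forall>i. expo (?us' @ us) i = 0"
    using eq by simp_all
  then obtain c d where c: "word ws \<otimes>\<^bsub>PA\<^esub> word ?us' = c \<odot>\<^bsub>PA\<^esub> \<one>\<^bsub>PA\<^esub>"
    and d: "word ?us' \<otimes>\<^bsub>PA\<^esub> word us = d \<odot>\<^bsub>PA\<^esub> \<one>\<^bsub>PA\<^esub>"
    using word_expo_zero[of "ws @ ?us'"] word_expo_zero[of "?us' @ us"] ws us us'
    by (auto simp: word_append PA_eq)
  have 1: "d \<odot>\<^bsub>PA\<^esub> word ws = c \<odot>\<^bsub>PA\<^esub> word us"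
  proof -
    have "word ws \<otimes>\<^bsub>PA\<^esub> word ?us' \<otimes>\<^bsub>PA\<^esub> word us = word ws \<otimes>\<^bsub>PA\<^esub> (word ?us' \<otimes>\<^bsub>PA\<^esub> word us)"
      by (rule PA.m_assoc[OF cl(1) cl(3) cl(2)])
    then show ?thesis
      unfolding c d using cl by (simp add: PA.smult_mult_left PA.smult_mult_right)
  qed
  show ?thesis
  proof (cases "d = 0")
    case False
    have "word ws = (inverse d * c) \<odot>\<^bsub>PA\<^esub> word us"
      using arg_cong[OF 1, of "\<lambda>x. inverse d \<odot>\<^bsub>PA\<^esub> x"] False cl by (simp add: PA.smult_smult)
    then show ?thesis
      by (auto simp: PA_eq)
  next
    \<comment> \<open>The torus is not yet known to be nonzero. Here a unit equals zero, so the ring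
      is zero and the two words coincide trivially.\<close>
    case True
    have "word us \<in> Units PA" "word ?us' \<in> Units PA"
      using word_Units us us' by (simp_all add: PA_eq)
    then have "d \<odot>\<^bsub>PA\<^esub> \<one>\<^bsub>PA\<^esub> \<in> Units PA"
      using d PA.Units_m_closed by metis
    then have "\<zero>\<^bsub>PA\<^esub> \<in> Units PA"
      using True by simp
    then have "\<one>\<^bsub>PA\<^esub> = \<zero>\<^bsub>PA\<^esub>"
      using PA.Units_l_inv[of "\<zero>\<^bsub>PA\<^esub>"] PA.Units_inv_closed[of "\<zero>\<^bsub>PA\<^esub>"] by simp
    then have "word ws = word us"
      using PA.one_zeroD cl by (metis singletonD)
    then show ?thesis
      using PA.smult_1[OF cl(2)] by (metis PA_eq)
  qed
qed


section \<open>Ideals of the torus and simplicity\<close>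

definition twist :: "(torus_gen list \<Rightarrow> 'k) \<Rightarrow> (torus_gen word \<Rightarrow>\<^sub>0 'k) \<Rightarrow> (torus_gen word \<Rightarrow>\<^sub>0 'k)" where
  "twist \<chi> p = Poly_Mapping.mapp (\<lambda>w c. \<chi> (letters w) * c) p"

lemma lookup_twist [simp]:
  "Poly_Mapping.lookup (twist \<chi> p) w = \<chi> (letters w) * Poly_Mapping.lookup p w"
  by (simp add: twist_def lookup_mapp when_def in_keys_iff)

lemma keys_twist: "Poly_Mapping.keys (twist \<chi> p) \<subseteq> Poly_Mapping.keys p"
  by (auto simp: in_keys_iff)

lemma twist_closed [simp]: "p \<in> carrier FA \<Longrightarrow> twist \<chi> p \<in> carrier FA"
  using keys_twist[of \<chi> p] unfolding carrier_FA_iff by blast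

lemma lookup_const_mult [simp]:
  "Poly_Mapping.lookup (const c * p) w = c * Poly_Mapping.lookup p w" for p :: "'g word \<Rightarrow>\<^sub>0 'k"
proof -
  have "Poly_Mapping.keys p \<subseteq> UNIV"
    by simp
  then show ?thesis
    by (induction p rule: poly_mapping_span_induct)
       (auto simp: const_def mult_single zero_word_def plus_word_def lookup_single distrib_left
         lookup_add when_def)
qed

text \<open>Conjugation by a generator is realized on lifts to the free algebra, where it is
  diagonal in the words; counting terms thus makes sense although the words are not independent in
  the torus.\<close>

lemma twist_commute:
  assumes g: "g \<in> torus_gens n" and p: "p \<in> carrier FA"
  shows "word [g] \<otimes>\<^bsub>PA\<^esub> proj p = proj (twist (word_factor g) p) \<otimes>\<^bsub>PA\<^esub> word [g]"
  using p
proof (induction p rule: FA_induct)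
  case zero
  have "twist (word_factor g) 0 = 0"
    by (rule poly_mapping_eqI) simp
  then show ?case
    using g by simp
next
  case (single ws c)
  have "twist (word_factor g) (const c * mon ws) = const (c * word_factor g ws) * mon ws"
    by (rule poly_mapping_eqI) (auto simp: mon_def lookup_single when_def)
  then show ?case
    using g single word_factor_commute[OF g single] unfolding PA_eq[symmetric]
    by (simp add: proj_smult PA.smult_mult_right PA.smult_mult_left PA.smult_smult
        flip: word_def)
next
  case (add p q)
  have "twist (word_factor g) (p + q) = twist (word_factor g) p + twist (word_factor g) q"
    by (rule poly_mapping_eqI) (simp add: lookup_add algebra_simps)
  then show ?case
    using add g by (simp add: proj_add PA.r_distr PA.l_distr)
qed

text \<open>
  Conjugation by a generator rescales each term of \<open>p\<close>; subtracting the multiple of \<open>p\<close> that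
  cancels the term \<open>w\<close> leaves an element of \<open>I\<close> with fewer terms.
\<close>

lemma minimal_commute:
  assumes I: "ideal I PA" and p: "p \<in> carrier FA" "proj p \<in> I"
    and minimal: "\<And>q. q \<in> carrier FA \<Longrightarrow> proj q \<in> I \<Longrightarrow>
      card (Poly_Mapping.keys q) < card (Poly_Mapping.keys p) \<Longrightarrow> proj q = \<zero>\<^bsub>PA\<^esub>"
    and w: "w \<in> Poly_Mapping.keys p" and g: "g \<in> torus_gens n"
  shows "word [g] \<otimes>\<^bsub>PA\<^esub> proj p =
    word_factor g (letters w) \<odot>\<^bsub>PA\<^esub> (proj p \<otimes>\<^bsub>PA\<^esub> word [g])"
proof -
  interpret I: ideal I PA by fact
  define \<chi> where "\<chi> = word_factor g (letters w)"
  define tp where "tp = twist (word_factor g) p"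
  define q where "q = tp + const (- \<chi>) * p"
  have tp: "tp \<in> carrier FA"
    using p by (simp add: tp_def)
  have q: "q \<in> carrier FA"
    using p tp by (simp add: q_def)
  have gu: "word [g] \<in> Units PA" "word [g] \<in> carrier PA" "inv\<^bsub>PA\<^esub> word [g] \<in> carrier PA"
    using word_gen_Units(1)[OF g] unfolding PA_eq[symmetric] by auto
  have tw: "word [g] \<otimes>\<^bsub>PA\<^esub> proj p = proj tp \<otimes>\<^bsub>PA\<^esub> word [g]"
    using twist_commute[OF g p(1)] by (simp add: tp_def)
  have "proj tp = (word [g] \<otimes>\<^bsub>PA\<^esub> proj p) \<otimes>\<^bsub>PA\<^esub> inv\<^bsub>PA\<^esub> word [g]"
    unfolding tw using gu tp by (simp add: PA.m_assoc)
  then have "proj tp \<in> I"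
    using p gu by (simp add: I.I_l_closed I.I_r_closed)
  moreover have "(- \<chi>) \<odot>\<^bsub>PA\<^esub> proj p \<in> I"
    by (rule PA.ideal_smult[OF I p(2)])
  ultimately have "proj q \<in> I"
    using p tp by (simp add: q_def proj_add proj_smult I.a_closed)
  moreover have "Poly_Mapping.keys q \<subseteq> Poly_Mapping.keys p - {w}"
    by (auto simp: q_def tp_def in_keys_iff lookup_add \<chi>_def)
  then have "card (Poly_Mapping.keys q) < card (Poly_Mapping.keys p)"
    using w by (intro psubset_card_mono) auto
  ultimately have "proj q = \<zero>\<^bsub>PA\<^esub>"
    using minimal[OF q] by blast
  moreover have "tp = q + const \<chi> * p"
    by (simp add: q_def const_uminus)
  ultimately have "proj tp = \<chi> \<odot>\<^bsub>PA\<^esub> proj p"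
    using p q by (simp add: proj_add proj_smult)
  then show ?thesis
    using tw p gu by (simp add: \<chi>_def PA.smult_mult_left)
qed

lemma centralI:
  assumes z: "z \<in> carrier PA"
    and comm: "\<And>g. g \<in> torus_gens n \<Longrightarrow> z \<otimes>\<^bsub>PA\<^esub> word [g] = word [g] \<otimes>\<^bsub>PA\<^esub> z"
  shows "z \<in> centre T"
proof -
  have word: "z \<otimes>\<^bsub>PA\<^esub> word ws = word ws \<otimes>\<^bsub>PA\<^esub> z" if "set ws \<subseteq> torus_gens n" for ws
    using that
  proof (induction ws)
    case (Cons g ws)
    have cl: "word [g] \<in> carrier PA" "word ws \<in> carrier PA"
      using Cons by auto
    have "z \<otimes>\<^bsub>PA\<^esub> (word [g] \<otimes>\<^bsub>PA\<^esub> word ws) = (word [g] \<otimes>\<^bsub>PA\<^esub> z) \<otimes>\<^bsub>PA\<^esub> word ws"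
      using comm[of g] Cons cl z by (simp flip: PA.m_assoc)
    also have "\<dots> = (word [g] \<otimes>\<^bsub>PA\<^esub> word ws) \<otimes>\<^bsub>PA\<^esub> z"
      using Cons cl z by (simp add: PA.m_assoc)
    finally show ?case
      using Cons by (simp add: word_Cons[of g ws])
  qed (use z in simp)
  have "z \<otimes>\<^bsub>PA\<^esub> proj p = proj p \<otimes>\<^bsub>PA\<^esub> z" if "p \<in> carrier FA" for p
    using that
  proof (induction p rule: FA_induct)
    case (single ws c)
    then show ?case
      using word[OF single] z by (simp add: proj_smult PA.smult_mult_left PA.smult_mult_right flip: word_def)
  next
    case (add p q)
    then show ?case
      using z by (simp add: proj_add PA.l_distr PA.r_distr)
  qed (use z in simp)
  then have "\<forall>x\<in>carrier PA. z \<otimes>\<^bsub>PA\<^esub> x = x \<otimes>\<^bsub>PA\<^esub> z"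
    unfolding PA_carrier by blast
  then show ?thesis
    using z unfolding centre_def PA_eq[symmetric] by blast
qed

definition independent :: bool where
  "independent \<longleftrightarrow> \<not> (\<exists>\<alpha> :: nat \<Rightarrow> int. (\<exists>i\<in>{1..n}. \<alpha> i \<noteq> 0) \<and>
     (\<forall>j\<in>{1..n}. (\<Prod>i=1..n. \<Lambda> i j powi \<alpha> i) = 1))"

lemma expo_outside: "set ws \<subseteq> torus_gens n \<Longrightarrow> i \<notin> {1..n} \<Longrightarrow> expo ws i = 0"
  using gen_index_range by (induction ws) auto

text \<open>The difference of the exponent vectors solves the equations that
  \<open>independent\<close> forbids for nonzero vectors. Commuting \<open>TY j\<close> past a word
  involves \<open>\<Lambda> j i\<close> where \<open>independent\<close> has its inverse
  \<open>\<Lambda> i j\<close>, so the quotient of the two factors appears upside down.\<close>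

lemma independent_expo_eq:
  assumes independent and ws: "set ws \<subseteq> torus_gens n" and us: "set us \<subseteq> torus_gens n"
    and eq: "\<And>j. j \<in> {1..n} \<Longrightarrow> word_factor (TY j) ws = word_factor (TY j) us"
  shows "expo ws i = expo us i"
proof -
  have "(\<Prod>i=1..n. \<Lambda> i j powi (expo ws i - expo us i)) = 1" if j: "j \<in> {1..n}" for j
  proof -
    have nz: "(\<Prod>i=1..n. \<Lambda> j i powi expo us i) \<noteq> 0"
      using Lambda(1) j by simp
    have "(\<Prod>i=1..n. \<Lambda> i j powi (expo ws i - expo us i)) =
        (\<Prod>i=1..n. \<Lambda> j i powi expo us i / \<Lambda> j i powi expo ws i)"
    proof (rule prod.cong)
      fix i assume i: "i \<in> {1..n}"
      show "\<Lambda> i j powi (expo ws i - expo us i) = \<Lambda> j i powi expo us i / \<Lambda> j i powi expo ws i"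
        unfolding Lambda(3)[OF j i, symmetric] using Lambda(1)[OF j i]
        by (simp add: power_int_diff power_int_inverse field_simps)
    qed simp
    also have "\<dots> = (\<Prod>i=1..n. \<Lambda> j i powi expo us i) / (\<Prod>i=1..n. \<Lambda> j i powi expo ws i)"
      by (simp add: prod_dividef)
    also have "\<dots> = 1"
      using eq[OF j] nz word_factor_eq[OF j] ws us by simp
    finally show ?thesis .
  qed
  then have "\<forall>i\<in>{1..n}. expo ws i - expo us i = 0"
    using assms(1)[unfolded independent_def not_ex, rule_format, of "\<lambda>i. expo ws i - expo us i"]
    by meson
  then show ?thesis
    using expo_outside ws us by (cases "i \<in> {1..n}") auto
qed

text \<open>In a nonzero ideal, choose a nonzero element whose lift \<open>p\<close> has as few
  words as possible. Either hypothesis forces \<open>proj p\<close> to be a nonzero multiple of the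
  unit \<open>W\<close> given by one word of \<open>p\<close>, so the ideal contains 1.\<close>

theorem simple_torus:
  assumes nontrivial: "\<one>\<^bsub>T\<^esub> \<noteq> \<zero>\<^bsub>T\<^esub>"
    and hyp: "centre T = scalars T \<or> independent"
  shows "simple_algebra T"
proof -
  have "I = carrier PA" if I: "ideal I PA" and nz: "I \<noteq> {\<zero>\<^bsub>PA\<^esub>}" for I
  proof -
    interpret I: ideal I PA by fact
    define M where "M = {p \<in> carrier FA. proj p \<in> I \<and> proj p \<noteq> \<zero>\<^bsub>PA\<^esub>}"
    have "M \<noteq> {}"
    proof -
      obtain x where "x \<in> I" "x \<noteq> \<zero>\<^bsub>PA\<^esub>"
        using nz I.zero_closed by blast
      moreover from this obtain p where "p \<in> carrier FA" "x = proj p"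
        using I.Icarr unfolding PA_carrier by blast
      ultimately show ?thesis
        by (auto simp: M_def)
    qed
    then obtain p where "p \<in> M"
      and min: "\<And>q. q \<in> M \<Longrightarrow> card (Poly_Mapping.keys p) \<le> card (Poly_Mapping.keys q)"
      using ex_has_least_nat[of "\<lambda>p. p \<in> M" _ "\<lambda>p. card (Poly_Mapping.keys p)"] by blast
    then have p: "p \<in> carrier FA" "proj p \<in> I" "proj p \<noteq> \<zero>\<^bsub>PA\<^esub>"
      by (auto simp: M_def)
    have minimal: "proj q = \<zero>\<^bsub>PA\<^esub>"
      if "q \<in> carrier FA" "proj q \<in> I" "card (Poly_Mapping.keys q) < card (Poly_Mapping.keys p)" for q
      using that min[of q] by (force simp: M_def)
    have comm: "word [g] \<otimes>\<^bsub>PA\<^esub> proj p = word_factor g (letters w) \<odot>\<^bsub>PA\<^esub> (proj p \<otimes>\<^bsub>PA\<^esub> word [g])"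
      if "w \<in> Poly_Mapping.keys p" "g \<in> torus_gens n" for w g
      using minimal_commute[OF I p(1,2) minimal that] .
    have "p \<noteq> 0"
      using p by auto
    then obtain w where w: "w \<in> Poly_Mapping.keys p"
      by (metis keys_eq_empty equals0I)
    define W where "W = word (letters w)"
    have ws: "set (letters w) \<subseteq> torus_gens n"
      using p(1) w unfolding carrier_FA_iff by blast
    then have W: "W \<in> Units PA" "W \<in> carrier PA" "inv\<^bsub>PA\<^esub> W \<in> carrier PA"
      using word_Units[of "letters w"] unfolding PA_eq[symmetric] W_def by auto
    have "\<exists>c. proj p = c \<odot>\<^bsub>PA\<^esub> W"
      using hyp
    proof
      assume centre: "centre T = scalars T"
      \<comment> \<open>By \<open>minimal_commute\<close>, \<open>proj p\<close> commutes with each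
        generator up to the same scalar as \<open>W\<close>; in the quotient the scalars cancel and
        \<open>z\<close> is central.\<close>
      define z where "z = proj p \<otimes>\<^bsub>PA\<^esub> inv\<^bsub>PA\<^esub> W"
      have z: "z \<in> carrier PA"
        using p W by (simp add: z_def)
      have pz: "proj p = z \<otimes>\<^bsub>PA\<^esub> W"
        using p W by (simp add: z_def PA.m_assoc)
      have "z \<otimes>\<^bsub>PA\<^esub> word [g] = word [g] \<otimes>\<^bsub>PA\<^esub> z" if g: "g \<in> torus_gens n" for g
      proof -
        define \<chi> where "\<chi> = word_factor g (letters w)"
        have gc: "word [g] \<in> carrier PA"
          using g by simp
        have \<chi>: "\<chi> \<noteq> 0"
          using word_factor_nonzero[OF g ws] by (simp add: \<chi>_def)
        have "word [g] \<otimes>\<^bsub>PA\<^esub> z \<otimes>\<^bsub>PA\<^esub> W = word [g] \<otimes>\<^bsub>PA\<^esub> proj p"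
          using gc z W by (simp add: pz PA.m_assoc)
        also have "\<dots> = \<chi> \<odot>\<^bsub>PA\<^esub> (proj p \<otimes>\<^bsub>PA\<^esub> word [g])"
          using comm[OF w g] by (simp add: \<chi>_def)
        also have "\<dots> = z \<otimes>\<^bsub>PA\<^esub> (\<chi> \<odot>\<^bsub>PA\<^esub> (W \<otimes>\<^bsub>PA\<^esub> word [g]))"
          using gc z W by (simp add: pz PA.m_assoc PA.smult_mult_right)
        also have "\<chi> \<odot>\<^bsub>PA\<^esub> (W \<otimes>\<^bsub>PA\<^esub> word [g]) = word [g] \<otimes>\<^bsub>PA\<^esub> W"
          using word_factor_commute[OF g ws] by (simp add: \<chi>_def W_def PA_eq)
        finally have "word [g] \<otimes>\<^bsub>PA\<^esub> z \<otimes>\<^bsub>PA\<^esub> W \<otimes>\<^bsub>PA\<^esub> inv\<^bsub>PA\<^esub> W =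
            z \<otimes>\<^bsub>PA\<^esub> (word [g] \<otimes>\<^bsub>PA\<^esub> W) \<otimes>\<^bsub>PA\<^esub> inv\<^bsub>PA\<^esub> W"
          by simp
        then show ?thesis
          using gc z W by (simp add: PA.m_assoc)
      qed
      then have "z \<in> scalars T"
        using centralI[OF z] centre by blast
      then obtain c where "z = c \<odot>\<^bsub>PA\<^esub> \<one>\<^bsub>PA\<^esub>"
        by (auto simp: scalars_def PA_eq)
      then show ?thesis
        using pz W by (auto simp: PA.smult_mult_left)
    next
      assume ind: independent
      have "\<exists>c. word (letters v) = c \<odot>\<^bsub>PA\<^esub> W" if v: "v \<in> Poly_Mapping.keys p" for v
      proof -
        have vs: "set (letters v) \<subseteq> torus_gens n"
          using p(1) v unfolding carrier_FA_iff by blast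
        have "word_factor (TY j) (letters v) = word_factor (TY j) (letters w)" if j: "j \<in> {1..n}" for j
        proof -
          have g: "TY j \<in> torus_gens n"
            using j by simp
          let ?u = "proj p \<otimes>\<^bsub>PA\<^esub> word [TY j]"
          have gu: "word [TY j] \<in> Units PA" "word [TY j] \<in> carrier PA"
            using word_gen_Units(1)[OF g] unfolding PA_eq[symmetric] by auto
          have u: "?u \<in> carrier PA"
            using p gu by simp
          have nz: "?u \<noteq> \<zero>\<^bsub>PA\<^esub>"
          proof
            assume "?u = \<zero>\<^bsub>PA\<^esub>"
            then have "?u \<otimes>\<^bsub>PA\<^esub> inv\<^bsub>PA\<^esub> word [TY j] = \<zero>\<^bsub>PA\<^esub>"
              using gu by simp
            then show False
              using p gu by (simp add: PA.m_assoc)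
          qed
          let ?a = "word_factor (TY j) (letters v)" and ?b = "word_factor (TY j) (letters w)"
          \<comment> \<open>Two words of \<open>p\<close> yield two scalars describing the same
            commutation; since \<open>?u\<close> is nonzero, the scalars agree.\<close>
          have ab: "?a \<odot>\<^bsub>PA\<^esub> ?u = ?b \<odot>\<^bsub>PA\<^esub> ?u"
            using comm[OF v g] comm[OF w g] by simp
          have "(?a - ?b) \<odot>\<^bsub>PA\<^esub> ?u \<oplus>\<^bsub>PA\<^esub> ?b \<odot>\<^bsub>PA\<^esub> ?u = \<zero>\<^bsub>PA\<^esub> \<oplus>\<^bsub>PA\<^esub> ?b \<odot>\<^bsub>PA\<^esub> ?u"
            using PA.smult_add_left[OF u, of "?a - ?b" ?b] ab u by simp
          then have "(?a - ?b) \<odot>\<^bsub>PA\<^esub> ?u = \<zero>\<^bsub>PA\<^esub>"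
            using PA.add.right_cancel[of "?b \<odot>\<^bsub>PA\<^esub> ?u"] u by simp
          then show ?thesis
            using PA.smult_cancel[of "?a - ?b" ?u "\<zero>\<^bsub>PA\<^esub>"] nz u by auto
        qed
        then have "expo (letters v) i = expo (letters w) i" for i
          using independent_expo_eq[OF ind vs ws] by blast
        then show ?thesis
          using word_expo_eq[OF vs ws] by (simp add: W_def PA_eq)
      qed
      then have keys: "Poly_Mapping.keys p \<subseteq>
          {v. set (letters v) \<subseteq> torus_gens n \<and> (\<exists>c. word (letters v) = c \<odot>\<^bsub>PA\<^esub> W)}" (is "_ \<subseteq> ?V")
        using p(1) unfolding carrier_FA_iff by blast
      have cl: "q \<in> carrier FA" if "Poly_Mapping.keys q \<subseteq> ?V" for q
        using that unfolding carrier_FA_iff by blast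
      show ?thesis
        using keys
      proof (induction p rule: poly_mapping_span_induct)
        case zero
        then show ?case
          using W by (intro exI[of _ 0]) simp
      next
        case (single v d)
        then show ?case
          using W by (auto simp: single_eq_mon proj_smult PA.smult_smult simp flip: word_def)
      next
        case (add p q)
        then obtain a b where ab: "proj p = a \<odot>\<^bsub>PA\<^esub> W" "proj q = b \<odot>\<^bsub>PA\<^esub> W"
          by blast
        then have "proj (p + q) = (a + b) \<odot>\<^bsub>PA\<^esub> W"
          using proj_add[OF cl[OF add.hyps(1)] cl[OF add.hyps(2)]] PA.smult_add_left[OF W(2)]
          by simp
        then show ?case ..
      qed
    qed
    then obtain c where c: "proj p = c \<odot>\<^bsub>PA\<^esub> W"
      by blast
    have "c \<noteq> 0"
      using c p(3) PA.smult_0_left[OF W(2)] by metis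
    then have "proj p \<in> Units PA"
      using PA.smult_Units[of c W] W by (simp add: c)
    then have "\<one>\<^bsub>PA\<^esub> \<in> I"
      using I.I_l_closed[OF p(2), of "inv\<^bsub>PA\<^esub> proj p"] by simp
    then show ?thesis
      by (rule I.one_imp_carrier)
  qed
  then show ?thesis
    using nontrivial PA.one_closed by (auto simp: simple_algebra_def PA_eq)
qed

end



section \<open>Linear functionals on the span of the ordered monomials\<close>

text \<open>
  The product is reversed because a left action on a space is a right action on its functionals.
\<close>

definition opposite_End :: "('k::field, ('m \<Rightarrow> 'k) \<Rightarrow> 'm \<Rightarrow> 'k) module" where
  "opposite_End =
     \<lparr>carrier = {L. (\<forall>f g. L (\<lambda>x. f x + g x) = (\<lambda>x. L f x + L g x)) \<and>
        (\<forall>c f. L (\<lambda>x. c * f x) = (\<lambda>x. c * L f x))},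
      monoid.mult = (\<lambda>L L' f. L' (L f)), one = (\<lambda>f. f), zero = (\<lambda>f x. 0),
      add = (\<lambda>L L' f x. L f x + L' f x), module.smult = (\<lambda>c L f x. c * L f x)\<rparr>"

lemma opposite_End_simps [simp]:
  "L \<in> carrier opposite_End \<longleftrightarrow> (\<forall>f g. L (\<lambda>x. f x + g x) = (\<lambda>x. L f x + L g x)) \<and>
        (\<forall>c f. L (\<lambda>x. c * f x) = (\<lambda>x. c * L f x))"
  "monoid.mult opposite_End = (\<lambda>L L' f. L' (L f))" "one opposite_End = (\<lambda>f. f)"
  "zero opposite_End = (\<lambda>f x. 0)" "add opposite_End = (\<lambda>L L' f x. L f x + L' f x)"
  "module.smult opposite_End = (\<lambda>c L f x. c * L f x)"
  by (auto simp: opposite_End_def)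

lemma opposite_End_k_algebra: "k_algebra (opposite_End :: ('k::field, ('m \<Rightarrow> 'k) \<Rightarrow> 'm \<Rightarrow> 'k) module)"
    (is "k_algebra ?E")
proof -
  have ab: "abelian_group ?E"
  proof (rule abelian_groupI)
    fix L assume "L \<in> carrier ?E"
    then show "\<exists>y\<in>carrier ?E. y \<oplus>\<^bsub>?E\<^esub> L = \<zero>\<^bsub>?E\<^esub>"
      by (intro bexI[of _ "\<lambda>f x. - L f x"]) auto
  qed (auto simp: algebra_simps)
  have ring: "ring ?E"
  proof (rule ringI[OF ab])
    show "Group.monoid ?E"
      by (rule monoidI) auto
  qed auto
  have "module ring_of_type_algebra ?E"
    by (intro moduleI ab cring_from_type_algebra)
       (auto simp: ring_of_type_algebra_def algebra_simps)
  then show ?thesis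
    by (intro k_algebra.intro ring k_algebra_axioms.intro) auto
qed

section \<open>The algebras S\<close>

text \<open>An injection into the naturals, giving a well-order on letters; multisets of letters
  then carry a linear well-order that is compatible with addition, with the empty multiset at the
  bottom.\<close>

fun s_gen_code :: "s_gen \<Rightarrow> nat" where
  "s_gen_code (SY i) = 2 * i"
| "s_gen_code (SX i) = 2 * i + 1"

lemma s_gen_code_inject: "s_gen_code g = s_gen_code h \<Longrightarrow> g = h"
  by (cases g; cases h) (simp_all add: double_not_eq_Suc_double Suc_double_not_eq_double)

instantiation s_gen :: wellorder
begin

definition less_eq_s_gen :: "s_gen \<Rightarrow> s_gen \<Rightarrow> bool" where
  "g \<le> h \<longleftrightarrow> s_gen_code g \<le> s_gen_code h"

definition less_s_gen :: "s_gen \<Rightarrow> s_gen \<Rightarrow> bool" where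
  "g < h \<longleftrightarrow> s_gen_code g < s_gen_code h"

instance
proof
  fix P :: "s_gen \<Rightarrow> bool" and g
  assume step: "\<And>g. (\<And>h. h < g \<Longrightarrow> P h) \<Longrightarrow> P g"
  show "P g"
    by (induction g rule: measure_induct_rule[where f = s_gen_code])
       (rule step, simp only: less_s_gen_def)
qed (auto simp: less_eq_s_gen_def less_s_gen_def intro: s_gen_code_inject)

end

definition s_gens :: "nat \<Rightarrow> nat \<Rightarrow> s_gen set" where
  "s_gens n r = SY ` {1..n} \<union> SX ` {1..r}"

lemma s_gens_iff [simp]:
  "SY i \<in> s_gens n r \<longleftrightarrow> i \<in> {1..n}" "SX i \<in> s_gens n r \<longleftrightarrow> i \<in> {1..r}"
  by (auto simp: s_gens_def)

definition s_relations :: "nat \<Rightarrow> nat \<Rightarrow> (nat \<Rightarrow> nat \<Rightarrow> 'k::field) \<Rightarrow>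
    ((s_gen word \<Rightarrow>\<^sub>0 'k) \<times> (s_gen word \<Rightarrow>\<^sub>0 'k)) set" where
  "s_relations n r \<Lambda> =
     {(gen (SY i) * gen (SY j), const (\<Lambda> i j) * gen (SY j) * gen (SY i))
       | i j. i \<in> {1..n} \<and> j \<in> {1..n}} \<union>
     {(gen (SX i) * gen (SY i), gen (SY i) * gen (SX i) + 1) | i. i \<in> {1..r}} \<union>
     {(gen (SX i) * gen (SY j), const (inverse (\<Lambda> i j)) * gen (SY j) * gen (SX i))
       | i j. i \<in> {1..r} \<and> j \<in> {1..n} \<and> i \<noteq> j} \<union>
     {(gen (SX i) * gen (SX j), const (\<Lambda> i j) * gen (SX j) * gen (SX i))
       | i j. i \<in> {1..r} \<and> j \<in> {1..r}}"

lemma s_relations_cases: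
  assumes "(p, q) \<in> s_relations n r \<Lambda>"
  obtains (YY) i j where "i \<in> {1..n}" "j \<in> {1..n}"
      "p = mon [SY i, SY j]" "q = const (\<Lambda> i j) * mon [SY j, SY i]"
    | (XY) i where "i \<in> {1..r}" "p = mon [SX i, SY i]" "q = mon [SY i, SX i] + 1"
    | (XY') i j where "i \<in> {1..r}" "j \<in> {1..n}" "i \<noteq> j"
      "p = mon [SX i, SY j]" "q = const (inverse (\<Lambda> i j)) * mon [SY j, SX i]"
    | (XX) i j where "i \<in> {1..r}" "j \<in> {1..r}"
      "p = mon [SX i, SX j]" "q = const (\<Lambda> i j) * mon [SX j, SX i]"
proof -
  have m: "mon [g, h] = gen g * gen h" for g h :: s_gen
    by (simp add: gen_eq_mon flip: mon_append)
  show ?thesis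
    using assms that unfolding s_relations_def m by (auto simp: mult.assoc)
qed

lemma S_algebra_eq: "S_algebra n r \<Lambda> = presented_algebra (s_gens n r) (s_relations n r \<Lambda>)"
  by (simp add: S_algebra_def s_relations_def s_gens_def)

lemma s_presentation:
  assumes "r \<le> n"
  shows "presentation (s_gens n r) (s_relations n r \<Lambda>)"
proof (rule presentation.intro)
  have mon: "mon ws \<in> carrier (free_algebra (s_gens n r))" if "set ws \<subseteq> s_gens n r" for ws
    using that by (simp add: free_algebra_simps(1))
  have cm: "const c * p \<in> carrier (free_algebra (s_gens n r))"
    if "p \<in> carrier (free_algebra (s_gens n r))" for c p
    using that k_algebra.smult_cl[OF free_algebra_k_algebra that, of c] by simp
  have one: "p + 1 \<in> carrier (free_algebra (s_gens n r))"
    if "p \<in> carrier (free_algebra (s_gens n r))" for p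
    using that unfolding free_algebra_simps(1) mem_Collect_eq by (intro keys_word_intros)
  fix p q assume "(p, q) \<in> s_relations n r \<Lambda>"
  then show "p \<in> carrier (free_algebra (s_gens n r)) \<and> q \<in> carrier (free_algebra (s_gens n r))"
    using assms by (cases rule: s_relations_cases) (auto intro!: mon cm one)
qed

section \<open>The action of S on formal ordered monomials\<close>

locale s_algebra = torus n \<Lambda> for n and \<Lambda> :: "nat \<Rightarrow> nat \<Rightarrow> 'k::field_char_0" +
  fixes r :: nat
  assumes r_le_n: "r \<le> n"
begin

sublocale S: presentation "s_gens n r" "s_relations n r \<Lambda>"
  by (rule s_presentation[OF r_le_n])

text \<open>
  \<open>S\<close> acts on the span of formal ordered monomials, which are indexed by multisets of letters and
  normalized so that, up to the scalar \<open>C i M\<close>, the generator \<open>y\<^sub>i\<close> adds a letter and \<open>x\<^sub>i\<close> is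
  adding a letter plus the derivation with respect to \<open>y\<^sub>i\<close>. Then \<open>act g f\<close> is the functional \<open>f\<close>
  composed with the action of \<open>g\<close>.
\<close>

definition E :: "nat \<Rightarrow> nat \<Rightarrow> 'k" where
  "E i j = (if 1 \<le> j \<and> j < i then \<Lambda> i j else 1)"

fun e :: "nat \<Rightarrow> s_gen \<Rightarrow> 'k" where
  "e i (SY j) = E i j"
| "e i (SX j) = inverse (E i j)"

text \<open>The monomials are thought of as ordered by index, with \<open>y_i\<close> before
  \<open>x_i\<close>. \<open>C i M\<close> is the price of moving \<open>y_i\<close> from the left
  of \<open>M\<close> to its place, past all letters of smaller index; \<open>x_i\<close> pays the
  inverse price. The multiplicity in \<open>act\<close> comes from
  \<open>x_i y_i^a = y_i^a x_i + a y_i^(a-1)\<close>.\<close>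

definition C :: "nat \<Rightarrow> s_gen multiset \<Rightarrow> 'k" where
  "C i M = (\<Prod>g\<in>#M. e i g)"

fun act :: "s_gen \<Rightarrow> (s_gen multiset \<Rightarrow> 'k) \<Rightarrow> s_gen multiset \<Rightarrow> 'k" where
  "act (SY i) f M = C i M * f (add_mset (SY i) M)"
| "act (SX i) f M = inverse (C i M) *
     (f (add_mset (SX i) M) + of_nat (count M (SY i)) * f (M - {#SY i#}))"

text \<open>Multisets may contain letters of any index, even 0. The guard \<open>1 \<le> j\<close>
  in \<open>E\<close>, with \<open>j < i \<le> n\<close>, makes sure that only entries of
  \<open>\<Lambda>\<close> known to be invertible are used.\<close>

lemma E_nonzero: "i \<in> {1..n} \<Longrightarrow> E i j \<noteq> 0"
  using Lambda(1)[of i j] by (auto simp: E_def)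

text \<open>Of two letters with distinct indices only one has to pass the other, so one of the two
  factors is 1 and antisymmetry supplies the rest.\<close>

lemma E_swap: "i \<in> {1..n} \<Longrightarrow> j \<in> {1..n} \<Longrightarrow> E i j = \<Lambda> i j * E j i"
  using Lambda[of i j] Lambda[of j i] by (auto simp: E_def field_simps)

lemma E_diag [simp]: "E i i = 1"
  by (simp add: E_def)

lemma C_nonzero: "i \<in> {1..n} \<Longrightarrow> C i M \<noteq> 0"
proof -
  assume "i \<in> {1..n}"
  then have "e i g \<noteq> 0" for g
    using E_nonzero by (cases g) auto
  then show ?thesis
    by (auto simp: C_def prod_mset_zero_iff)
qed

lemma C_add [simp]:
  "C i (add_mset (SY j) M) = E i j * C i M" "C i (add_mset (SX j) M) = C i M / E i j"
  by (simp_all add: C_def field_simps)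

lemma C_remove: "i \<in> {1..n} \<Longrightarrow> SY j \<in># M \<Longrightarrow> C i (M - {#SY j#}) = C i M / E i j"
  using C_add(1)[of i j "M - {#SY j#}"] E_nonzero[of i j] by (simp add: field_simps)

lemma act_YY:
  "i \<in> {1..n} \<Longrightarrow> j \<in> {1..n} \<Longrightarrow> act (SY j) (act (SY i) f) M = \<Lambda> i j * act (SY i) (act (SY j) f) M"
  using E_swap[of i j] by (simp add: add_mset_commute)

text \<open>Adjoining \<open>SY i\<close> raises its multiplicity by one, and the two derivation
  terms therefore differ by \<open>f M\<close>. The scalars cancel because
  \<open>E i i = 1\<close>.\<close>

lemma act_XY:
  "i \<in> {1..n} \<Longrightarrow> act (SY i) (act (SX i) f) M = act (SX i) (act (SY i) f) M + f M"
  using C_nonzero[of i M] C_remove[of i i M]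
  by (cases "SY i \<in># M") (auto simp: add_mset_commute field_simps not_in_iff)

text \<open>For distinct indices, deleting \<open>SY i\<close> and adjoining \<open>SY j\<close> are
  independent operations, so only scalars remain to be compared, through
  \<open>E_swap\<close>.\<close>

lemma act_XY':
  assumes "i \<in> {1..n}" "j \<in> {1..n}" "i \<noteq> j"
  shows "act (SY j) (act (SX i) f) M = inverse (\<Lambda> i j) * act (SX i) (act (SY j) f) M"
proof -
  have "add_mset (SY j) M - {#SY i#} = add_mset (SY j) (M - {#SY i#})"
    using assms by (simp add: diff_add_mset_swap)
  then show ?thesis
    using assms C_nonzero[of i M] C_nonzero[of j M] C_remove[of j i M] E_swap[of i j]
      E_nonzero[of j i] E_nonzero[of i j] Lambda(1)[of i j]
    by (cases "SY i \<in># M") (auto simp: add_mset_commute field_simps not_in_iff)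
qed

lemma act_XX:
  assumes "i \<in> {1..n}" "j \<in> {1..n}"
  shows "act (SX j) (act (SX i) f) M = \<Lambda> i j * act (SX i) (act (SX j) f) M"
proof (cases "i = j")
  case True
  then show ?thesis
    using Lambda(2)[OF assms] by simp
next
  case False
  have *: "add_mset (SX a) M - {#SY b#} = add_mset (SX a) (M - {#SY b#})" for a b
    by (simp add: diff_add_mset_swap)
  have "E i j \<noteq> 0" "E j i \<noteq> 0" "C i M \<noteq> 0" "C j M \<noteq> 0" "\<Lambda> i j \<noteq> 0"
    using assms E_nonzero C_nonzero Lambda by blast+
  then show ?thesis
    using assms False E_swap[OF assms]
    by (cases "SY i \<in># M"; cases "SY j \<in># M")
       (auto simp: * C_remove add_mset_commute field_simps not_in_iff diff_diff_add)
qed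

fun act_word :: "s_gen list \<Rightarrow> (s_gen multiset \<Rightarrow> 'k) \<Rightarrow> s_gen multiset \<Rightarrow> 'k" where
  "act_word [] f = f"
| "act_word (g # ws) f = act_word ws (act g f)"

lemma act_hom:
  obtains h where "h \<in> alg_hom S.PA opposite_End"
    "\<And>ws. set ws \<subseteq> s_gens n r \<Longrightarrow> h (S.word ws) = act_word ws"
proof -
  interpret O: k_algebra "opposite_End :: ('k, (s_gen multiset \<Rightarrow> 'k) \<Rightarrow> s_gen multiset \<Rightarrow> 'k) module"
    by (rule opposite_End_k_algebra)
  have "act g \<in> carrier opposite_End" for g
    by (cases g) (auto simp: algebra_simps fun_eq_iff)
  then have act: "act \<in> s_gens n r \<rightarrow> carrier opposite_End"
    by blast
  have val: "O.word_value act ws = act_word ws" for ws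
    by (induction ws) auto
  have eval: "O.free_eval act (mon ws) = act_word ws" if "set ws \<subseteq> s_gens n r" for ws
    using that by (simp add: O.free_eval_mon[OF act] val del: opposite_End_simps)
  have eval_c: "O.free_eval act (const c * mon ws) = (\<lambda>f M. c * act_word ws f M)"
    if "set ws \<subseteq> s_gens n r" for c ws
    using O.free_eval_alg_hom[OF act] that by (simp add: eval alg_hom_def S.closed_FA)
  have eval_1: "O.free_eval act (mon ws + 1) = (\<lambda>f M. act_word ws f M + f M)"
    if "set ws \<subseteq> s_gens n r" for ws
    using O.free_eval_add[OF act, of "mon ws" "mon []"] that eval[of "[]"]
    by (simp add: eval S.closed_FA)
  have "O.free_eval act p = O.free_eval act q" if "(p, q) \<in> s_relations n r \<Lambda>" for p q
    using that
  proof (cases rule: s_relations_cases)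
    case (YY i j)
    then show ?thesis
      by (simp add: eval eval_c fun_eq_iff act_YY[OF YY(1,2)] del: act.simps)
  next
    case (XY i)
    then have "i \<in> {1..n}"
      using r_le_n by auto
    from act_XY[OF this] show ?thesis
      using XY \<open>i \<in> {1..n}\<close> by (simp add: eval eval_1 fun_eq_iff del: act.simps)
  next
    case (XY' i j)
    then have "i \<in> {1..n}"
      using r_le_n by auto
    from act_XY'[OF this XY'(2,3)] show ?thesis
      using XY' \<open>i \<in> {1..n}\<close> by (simp add: eval eval_c fun_eq_iff del: act.simps)
  next
    case (XX i j)
    then have "i \<in> {1..n}" "j \<in> {1..n}"
      using r_le_n by auto
    from act_XX[OF this] show ?thesis
      using XX by (simp add: eval eval_c fun_eq_iff del: act.simps)
  qed
  from S.universal_property[OF opposite_End_k_algebra act this]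
  obtain h where h: "h \<in> alg_hom S.PA opposite_End"
    "\<And>p. p \<in> carrier S.FA \<Longrightarrow> h (S.proj p) = O.free_eval act p"
    by blast
  then show ?thesis
    using that eval by (simp add: S.word_def)
qed

end



section \<open>Leading terms\<close>

context s_algebra
begin

text \<open>The span of all words below \<open>M\<close>, ordered or not: products of words then
  stay inside such spans without any rewriting to a normal form.\<close>

inductive_set low :: "s_gen multiset \<Rightarrow> (s_gen word \<Rightarrow>\<^sub>0 'k) set set" for M where
  zero: "\<zero>\<^bsub>S.PA\<^esub> \<in> low M"
| word: "set ws \<subseteq> s_gens n r \<Longrightarrow> mset ws < M \<Longrightarrow> c \<odot>\<^bsub>S.PA\<^esub> S.word ws \<in> low M"
| add: "x \<in> low M \<Longrightarrow> y \<in> low M \<Longrightarrow> x \<oplus>\<^bsub>S.PA\<^esub> y \<in> low M"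

lemma low_closed: "x \<in> low M \<Longrightarrow> x \<in> carrier S.PA"
  by (induction rule: low.induct) auto

lemma low_mono: "x \<in> low N \<Longrightarrow> N \<le> M \<Longrightarrow> x \<in> low M"
  by (induction rule: low.induct) (auto intro: low.intros less_le_trans)

lemma low_smult: "x \<in> low M \<Longrightarrow> c \<odot>\<^bsub>S.PA\<^esub> x \<in> low M"
  by (induction rule: low.induct)
     (auto intro: low.intros simp: S.PA.smult_add_right S.PA.smult_smult low_closed)

lemma low_word_left:
  assumes "x \<in> low M" "set us \<subseteq> s_gens n r"
  shows "S.word us \<otimes>\<^bsub>S.PA\<^esub> x \<in> low (mset us + M)"
  using assms(1)
proof (induction rule: low.induct)
  case zero
  then show ?case using assms(2) low.zero by simp
next
  case (word ws c)
  then show ?case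
    using assms(2) low.word[of "us @ ws" "mset us + M" c]
    by (simp add: S.word_append S.PA.smult_mult_right)
next
  case (add x y)
  then show ?case
    using assms(2) by (simp add: S.PA.r_distr low_closed low.add)
qed

lemma low_word_right:
  assumes "x \<in> low M" "set us \<subseteq> s_gens n r"
  shows "x \<otimes>\<^bsub>S.PA\<^esub> S.word us \<in> low (M + mset us)"
  using assms(1)
proof (induction rule: low.induct)
  case zero
  then show ?case using assms(2) low.zero by simp
next
  case (word ws c)
  then show ?case
    using assms(2) low.word[of "ws @ us" "M + mset us" c]
    by (simp add: S.word_append S.PA.smult_mult_left)
next
  case (add x y)
  then show ?case
    using assms(2) by (simp add: S.PA.l_distr low_closed low.add)
qed

lemma low_mult:
  assumes "x \<in> low M" "y \<in> low N"
  shows "x \<otimes>\<^bsub>S.PA\<^esub> y \<in> low (M + N)"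
  using assms(1)
proof (induction rule: low.induct)
  case zero
  then show ?case using low_closed[OF assms(2)] low.zero by simp
next
  case (word ws c)
  have "S.word ws \<otimes>\<^bsub>S.PA\<^esub> y \<in> low (M + N)"
    by (rule low_mono[OF low_word_left[OF assms(2) word(1)]]) (use word(2) in simp)
  then show ?case
    using low_closed[OF assms(2)] word by (simp add: S.PA.smult_mult_left low_smult)
next
  case (add x x')
  then show ?case
    using low_closed[OF assms(2)] by (simp add: S.PA.l_distr low_closed low.add)
qed

lemma low_one: "{#} < M \<Longrightarrow> c \<odot>\<^bsub>S.PA\<^esub> \<one>\<^bsub>S.PA\<^esub> \<in> low M"
  using low.word[of "[]" M c] by simp

section \<open>Reordering words in S and in the torus simultaneously\<close>

fun tor :: "s_gen \<Rightarrow> torus_gen" where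
  "tor (SY i) = TY i"
| "tor (SX i) = TYinv i"

lemma tor_closed [simp]: "g \<in> s_gens n r \<Longrightarrow> tor g \<in> torus_gens n"
  using r_le_n by (cases g) auto

lemma tor_word_closed: "set ws \<subseteq> s_gens n r \<Longrightarrow> set (map tor ws) \<subseteq> torus_gens n"
  by auto

definition symbol :: "s_gen list \<Rightarrow> (torus_gen word \<Rightarrow>\<^sub>0 'k) set" where
  "symbol ws = word (map tor ws)"

lemma symbol_closed [simp]: "set ws \<subseteq> s_gens n r \<Longrightarrow> symbol ws \<in> carrier T"
  using word_closed[OF tor_word_closed] by (simp add: symbol_def PA_eq)

lemma symbol_Units: "set ws \<subseteq> s_gens n r \<Longrightarrow> symbol ws \<in> Units T"
  using word_Units[OF tor_word_closed] by (simp add: symbol_def)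

lemma symbol_append:
  "set us \<subseteq> s_gens n r \<Longrightarrow> set ws \<subseteq> s_gens n r \<Longrightarrow> symbol (us @ ws) = symbol us \<otimes>\<^bsub>T\<^esub> symbol ws"
  using word_append[OF tor_word_closed tor_word_closed] by (simp add: symbol_def PA_eq)

sublocale T: k_algebra T
  by (rule quantum_torus_k_algebra)

text \<open>One and the same \<open>c\<close> serves in \<open>S\<close>, modulo lower terms, and in
  the torus, exactly. This coupling makes the symbol of a leading term independent of the word
  representing it.\<close>

definition reorder :: "s_gen list \<Rightarrow> s_gen list \<Rightarrow> bool" where
  "reorder ws us \<longleftrightarrow> set ws \<subseteq> s_gens n r \<and> set us \<subseteq> s_gens n r \<and> mset ws = mset us \<and>
     (\<exists>c y. c \<noteq> 0 \<and> y \<in> low (mset us) \<and> S.word ws = c \<odot>\<^bsub>S.PA\<^esub> S.word us \<oplus>\<^bsub>S.PA\<^esub> y \<and>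
        symbol ws = c \<odot>\<^bsub>T\<^esub> symbol us)"

lemma reorder_refl: "set ws \<subseteq> s_gens n r \<Longrightarrow> reorder ws ws"
  unfolding reorder_def by (auto intro!: exI[of _ 1] exI[of _ "\<zero>\<^bsub>S.PA\<^esub>"] low.zero)

lemma reorder_trans:
  assumes "reorder us vs" "reorder vs ws"
  shows "reorder us ws"
proof -
  obtain c y d z where c: "c \<noteq> 0" "y \<in> low (mset vs)"
      "S.word us = c \<odot>\<^bsub>S.PA\<^esub> S.word vs \<oplus>\<^bsub>S.PA\<^esub> y" "symbol us = c \<odot>\<^bsub>T\<^esub> symbol vs"
    and d: "d \<noteq> 0" "z \<in> low (mset ws)"
      "S.word vs = d \<odot>\<^bsub>S.PA\<^esub> S.word ws \<oplus>\<^bsub>S.PA\<^esub> z" "symbol vs = d \<odot>\<^bsub>T\<^esub> symbol ws"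
    using assms unfolding reorder_def by metis
  have s: "set us \<subseteq> s_gens n r" "set vs \<subseteq> s_gens n r" "set ws \<subseteq> s_gens n r"
      "mset us = mset vs" "mset vs = mset ws"
    using assms unfolding reorder_def by auto
  have cl: "y \<in> carrier S.PA" "z \<in> carrier S.PA"
    using c d low_closed by auto
  have "S.word us = (c * d) \<odot>\<^bsub>S.PA\<^esub> S.word ws \<oplus>\<^bsub>S.PA\<^esub> (c \<odot>\<^bsub>S.PA\<^esub> z \<oplus>\<^bsub>S.PA\<^esub> y)"
    unfolding c(3) d(3) using s cl by (simp add: S.PA.smult_add_right S.PA.smult_smult S.PA.a_assoc)
  moreover have "c \<odot>\<^bsub>S.PA\<^esub> z \<oplus>\<^bsub>S.PA\<^esub> y \<in> low (mset ws)"
    using c(2) d(2) s by (simp add: low.add low_smult)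
  moreover have "symbol us = (c * d) \<odot>\<^bsub>T\<^esub> symbol ws"
    unfolding c(4) d(4) using s by (simp add: T.smult_smult)
  ultimately show ?thesis
    using s c(1) d(1) unfolding reorder_def by (metis no_zero_divisors)
qed

lemma reorder_context:
  assumes "reorder ws us" "set as \<subseteq> s_gens n r" "set bs \<subseteq> s_gens n r"
  shows "reorder (as @ ws @ bs) (as @ us @ bs)"
proof -
  obtain c y where c: "c \<noteq> 0" "y \<in> low (mset us)"
      "S.word ws = c \<odot>\<^bsub>S.PA\<^esub> S.word us \<oplus>\<^bsub>S.PA\<^esub> y" "symbol ws = c \<odot>\<^bsub>T\<^esub> symbol us"
    using assms unfolding reorder_def by metis
  have s: "set us \<subseteq> s_gens n r" "set ws \<subseteq> s_gens n r" "mset ws = mset us"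
    using assms unfolding reorder_def by auto
  let ?y = "S.word as \<otimes>\<^bsub>S.PA\<^esub> (y \<otimes>\<^bsub>S.PA\<^esub> S.word bs)"
  have y: "y \<in> carrier S.PA"
    using c low_closed by auto
  have "?y \<in> low (mset (as @ us @ bs))"
    using low_word_left[OF low_word_right[OF c(2) assms(3)] assms(2)] by simp
  moreover have "S.word (as @ ws @ bs) = c \<odot>\<^bsub>S.PA\<^esub> S.word (as @ us @ bs) \<oplus>\<^bsub>S.PA\<^esub> ?y"
    using s assms y
    by (simp add: S.word_append c(3) S.PA.l_distr S.PA.r_distr S.PA.smult_mult_left
        S.PA.smult_mult_right)
  moreover have "symbol (as @ ws @ bs) = c \<odot>\<^bsub>T\<^esub> symbol (as @ us @ bs)"
    using s assms by (simp add: symbol_append c(4) T.smult_mult_left T.smult_mult_right)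
  ultimately show ?thesis
    using s assms c(1) unfolding reorder_def by (auto intro!: exI[of _ c] exI[of _ ?y])
qed

lemma s_word_YY:
  assumes "i \<in> {1..n}" "j \<in> {1..n}"
  shows "S.word [SY i, SY j] = \<Lambda> i j \<odot>\<^bsub>S.PA\<^esub> S.word [SY j, SY i]"
proof -
  have m: "gen a * gen b = mon [a, b]" for a b :: s_gen
    by (simp add: gen_eq_mon flip: mon_append)
  have "(mon [SY i, SY j], const (\<Lambda> i j) * mon [SY j, SY i]) \<in> s_relations n r \<Lambda>"
    using assms unfolding s_relations_def by (auto simp: m mult.assoc)
  from S.proj_relation[OF this] show ?thesis
    using assms by (simp add: S.word_def S.proj_smult)
qed

text \<open>Only the pair \<open>SX i\<close>, \<open>SY i\<close> produces a constant term; its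
  scalar 1 agrees with \<open>comm_factor\<close> because \<open>\<Lambda> i i = 1\<close>.\<close>

lemma s_word_swap:
  assumes "g \<in> s_gens n r" "h \<in> s_gens n r"
  shows "\<exists>d. S.word [g, h] =
    comm_factor (tor g) (tor h) \<odot>\<^bsub>S.PA\<^esub> S.word [h, g] \<oplus>\<^bsub>S.PA\<^esub> d \<odot>\<^bsub>S.PA\<^esub> \<one>\<^bsub>S.PA\<^esub>"
proof -
  have m: "gen a * gen b = mon [a, b]" for a b :: s_gen
    by (simp add: gen_eq_mon flip: mon_append)
  have XY: "S.word [SX i, SY i] = S.word [SY i, SX i] \<oplus>\<^bsub>S.PA\<^esub> \<one>\<^bsub>S.PA\<^esub>"
    if "i \<in> {1..r}" for i
  proof -
    have "(mon [SX i, SY i], mon [SY i, SX i] + 1) \<in> s_relations n r \<Lambda>"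
      using that unfolding s_relations_def by (auto simp: m mult.assoc)
    from S.proj_relation[OF this] show ?thesis
      using that r_le_n by (simp add: S.word_def S.proj_add)
  qed
  have XY': "S.word [SX i, SY j] = inverse (\<Lambda> i j) \<odot>\<^bsub>S.PA\<^esub> S.word [SY j, SX i]"
    if "i \<in> {1..r}" "j \<in> {1..n}" "i \<noteq> j" for i j
  proof -
    have "(mon [SX i, SY j], const (inverse (\<Lambda> i j)) * mon [SY j, SX i]) \<in> s_relations n r \<Lambda>"
      using that unfolding s_relations_def by (auto simp: m mult.assoc)
    from S.proj_relation[OF this] show ?thesis
      using that by (simp add: S.word_def S.proj_smult)
  qed
  have XX: "S.word [SX i, SX j] = \<Lambda> i j \<odot>\<^bsub>S.PA\<^esub> S.word [SX j, SX i]"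
    if "i \<in> {1..r}" "j \<in> {1..r}" for i j
  proof -
    have "(mon [SX i, SX j], const (\<Lambda> i j) * mon [SX j, SX i]) \<in> s_relations n r \<Lambda>"
      using that unfolding s_relations_def by (auto simp: m mult.assoc)
    from S.proj_relation[OF this] show ?thesis
      using that by (simp add: S.word_def S.proj_smult)
  qed
  have zero: "\<exists>d. x = x \<oplus>\<^bsub>S.PA\<^esub> d \<odot>\<^bsub>S.PA\<^esub> \<one>\<^bsub>S.PA\<^esub>" if "x \<in> carrier S.PA" for x
    using that by (intro exI[of _ 0]) simp
  show ?thesis
  proof (cases g; cases h)
    fix i j assume *: "g = SY i" "h = SY j"
    then show ?thesis
      using assms s_word_YY[of i j] zero[of "S.word [g, h]"] by (simp add: comm_factor_def)
  next
    fix i j assume *: "g = SX i" "h = SX j"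
    then show ?thesis
      using assms XX[of i j] zero[of "S.word [g, h]"] by (simp add: comm_factor_def)
  next
    fix i j assume *: "g = SX i" "h = SY j"
    show ?thesis
    proof (cases "i = j")
      case True
      then have "comm_factor (tor g) (tor h) = 1"
        using assms * Lambda(2)[of j j] by (simp add: comm_factor_def)
      then show ?thesis
        using True XY[of i] assms * by (intro exI[of _ 1]) simp
    next
      case False
      then show ?thesis
        using assms * XY'[of i j] zero[of "S.word [g, h]"]
        by (simp add: comm_factor_def power_int_minus)
    qed
  next
    fix i j assume *: "g = SY i" "h = SX j"
    show ?thesis
    proof (cases "i = j")
      case True
      then have "comm_factor (tor g) (tor h) = 1"
        using assms * Lambda(2)[of j j] by (simp add: comm_factor_def)
      \<comment> \<open>The relation for \<open>SX i\<close>, \<open>SY i\<close> is read backwards: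
        the summand 1 is absorbed into \<open>S.word [SX i, SY i]\<close>, which leaves the constant
        -1.\<close>
      moreover have "S.word [SY i, SX i] =
          S.word [SY i, SX i] \<oplus>\<^bsub>S.PA\<^esub> (1 + - 1) \<odot>\<^bsub>S.PA\<^esub> \<one>\<^bsub>S.PA\<^esub>"
        using True assms * by simp
      then have "S.word [SY i, SX i] = S.word [SX i, SY i] \<oplus>\<^bsub>S.PA\<^esub> (- 1) \<odot>\<^bsub>S.PA\<^esub> \<one>\<^bsub>S.PA\<^esub>"
        unfolding S.PA.smult_add_left[OF S.PA.one_closed]
        using True assms * XY[of i] by (simp add: S.PA.a_assoc)
      ultimately show ?thesis
        using True * assms by (intro exI[of _ "- 1"]) simp
    next
      case False
      have ij: "j \<in> {1..r}" "i \<in> {1..n}" "j \<in> {1..n}"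
        using assms * r_le_n by auto
      have "\<Lambda> j i \<odot>\<^bsub>S.PA\<^esub> S.word [SX j, SY i] = S.word [SY i, SX j]"
        using XY'[OF ij(1,2)] False Lambda(1)[OF ij(3,2)] assms *
        by (simp add: S.PA.smult_smult)
      moreover have "comm_factor (tor g) (tor h) = \<Lambda> j i"
        using * Lambda(3)[OF ij(2,3)] by (simp add: comm_factor_def power_int_minus)
      ultimately show ?thesis
        using * zero[of "S.word [g, h]"] assms by simp
    qed
  qed
qed

lemma reorder_swap:
  assumes "g \<in> s_gens n r" "h \<in> s_gens n r"
  shows "reorder [g, h] [h, g]"
proof -
  obtain d where d: "S.word [g, h] =
    comm_factor (tor g) (tor h) \<odot>\<^bsub>S.PA\<^esub> S.word [h, g] \<oplus>\<^bsub>S.PA\<^esub> d \<odot>\<^bsub>S.PA\<^esub> \<one>\<^bsub>S.PA\<^esub>"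
    using s_word_swap[OF assms] by blast
  have "{#} < mset [h, g]"
    by simp
  then have "d \<odot>\<^bsub>S.PA\<^esub> \<one>\<^bsub>S.PA\<^esub> \<in> low (mset [h, g])"
    by (rule low_one)
  moreover have "symbol [g, h] = comm_factor (tor g) (tor h) \<odot>\<^bsub>T\<^esub> symbol [h, g]"
    using word_gens_commute[of "tor g" "tor h"] word_append[of "[tor g]" "[tor h]"]
      word_append[of "[tor h]" "[tor g]"] assms
    by (simp add: symbol_def PA_eq)
  ultimately show ?thesis
    using d comm_factor_nonzero[of "tor g" "tor h"] assms unfolding reorder_def by fastforce
qed

lemma reorder_to_front:
  "set us \<subseteq> s_gens n r \<Longrightarrow> g \<in> s_gens n r \<Longrightarrow> set vs \<subseteq> s_gens n r \<Longrightarrow>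
     reorder (us @ g # vs) (g # us @ vs)"
proof (induction us)
  case (Cons a us)
  have "reorder (a # us @ g # vs) (a # g # us @ vs)"
    using reorder_context[OF Cons.IH, of "[a]" "[]"] Cons by simp
  moreover have "reorder (a # g # us @ vs) (g # a # us @ vs)"
    using reorder_context[OF reorder_swap[of a g], of "[]" "us @ vs"] Cons by simp
  ultimately show ?case
    using reorder_trans by simp
qed (simp add: reorder_refl)

text \<open>Adjacent swaps bring the first letter of \<open>us\<close> to the front of
  \<open>ws\<close>; induction sorts the rest. The lower terms created by a swap remain lower inside
  a longer word by \<open>reorder_context\<close>.\<close>

lemma reorder_mset:
  "set ws \<subseteq> s_gens n r \<Longrightarrow> mset ws = mset us \<Longrightarrow> reorder ws us"
proof (induction us arbitrary: ws)
  case (Cons g us)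
  then have "g \<in> set ws"
    by (metis list.set_intros(1) set_mset_mset)
  then obtain as bs where ws: "ws = as @ g # bs"
    by (meson split_list)
  have "reorder (as @ bs) us"
    using Cons by (auto simp: ws)
  from reorder_context[OF this, of "[g]" "[]"] have "reorder (g # as @ bs) (g # us)"
    using Cons by (simp add: ws)
  moreover have "reorder ws (g # as @ bs)"
    using Cons unfolding ws by (intro reorder_to_front) auto
  ultimately show ?case
    using reorder_trans by blast
qed (simp add: reorder_refl)


section \<open>Triangularity of the action and nonvanishing of leading coefficients\<close>

lemma act_low:
  assumes f: "\<And>K. K < add_mset g N \<Longrightarrow> f K = 0"
  shows "K < N \<Longrightarrow> act g f K = 0"
    and "g \<in> s_gens n r \<Longrightarrow> act g f N = 0 \<longleftrightarrow> f (add_mset g N) = 0"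
proof -
  \<comment> \<open>The derivation term of \<open>x_i\<close> deletes a letter, so it stays strictly
    below the multiset to which \<open>g\<close> has been added and cannot disturb the top
    coefficient.\<close>
  have remove: "M - {#SY i#} < add_mset g N" if "M \<le> N" for M i
  proof -
    have "M - {#SY i#} \<le> M"
      by (simp add: subset_eq_imp_le_multiset)
    also have "\<dots> < add_mset g M"
      by simp
    also have "\<dots> \<le> add_mset g N"
      using that by simp
    finally show ?thesis .
  qed
  show "K < N \<Longrightarrow> act g f K = 0"
    using f remove[of K] by (cases g) simp_all
  assume "g \<in> s_gens n r"
  then show "act g f N = 0 \<longleftrightarrow> f (add_mset g N) = 0"
    using f remove[of N] C_nonzero r_le_n by (cases g) simp_all
qed

text \<open>Triangularity iterated along the word. For \<open>N\<close> empty it says that a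
  functional vanishing below the multiset of \<open>ws\<close> sees, on \<open>ws\<close> applied to
  the empty monomial, exactly its top term.\<close>

lemma act_word_low:
  assumes "\<And>K. K < mset ws + N \<Longrightarrow> f K = 0" "set ws \<subseteq> s_gens n r"
  shows "(\<forall>K<N. act_word ws f K = 0) \<and> (act_word ws f N = 0 \<longleftrightarrow> f (mset ws + N) = 0)"
  using assms
proof (induction ws arbitrary: f)
  case (Cons g ws)
  have *: "\<And>K. K < add_mset g (mset ws + N) \<Longrightarrow> f K = 0"
    using Cons(2) by simp
  have "g \<in> s_gens n r" "set ws \<subseteq> s_gens n r"
    using Cons(3) by simp_all
  then show ?case
    using Cons.IH[of "act g f"] act_low[OF *] by simp
qed simp

text \<open>The functional dual to the monomial of \<open>ws\<close> detects the leading coefficient.\<close>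

lemma low_leading_coeff:
  assumes ws: "set ws \<subseteq> s_gens n r" and y: "y \<in> low (mset ws)"
    and eq: "c \<odot>\<^bsub>S.PA\<^esub> S.word ws \<oplus>\<^bsub>S.PA\<^esub> y = \<zero>\<^bsub>S.PA\<^esub>"
  shows "c = 0"
proof -
  obtain h where h: "h \<in> alg_hom S.PA opposite_End"
    and h_word: "\<And>ws. set ws \<subseteq> s_gens n r \<Longrightarrow> h (S.word ws) = act_word ws"
    using act_hom by blast
  have hom: "h (x \<oplus>\<^bsub>S.PA\<^esub> z) f K = h x f K + h z f K" "h (a \<odot>\<^bsub>S.PA\<^esub> x) f K = a * h x f K"
    if "x \<in> carrier S.PA" "z \<in> carrier S.PA" for x z a f K
    using h that ring_hom_add[of h S.PA opposite_End x z] by (auto simp: alg_hom_def)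
  have h0: "h \<zero>\<^bsub>S.PA\<^esub> f K = 0" for f K
    using hom(2)[of "\<zero>\<^bsub>S.PA\<^esub>" "\<zero>\<^bsub>S.PA\<^esub>" 0 f K] by simp
  define f :: "s_gen multiset \<Rightarrow> 'k" where "f = (\<lambda>K. if K = mset ws then 1 else 0)"
  have f: "f K = 0" if "K < mset us" "mset us \<le> mset ws" for K us
    using that by (auto simp: f_def)
  have val: "act_word us f {#} = 0 \<longleftrightarrow> f (mset us) = 0"
    if "set us \<subseteq> s_gens n r" "mset us \<le> mset ws" for us
    using act_word_low[of us "{#}" f] f that by simp
  have "h y f {#} = 0"
    using y
  proof (induction rule: low.induct)
    case (word us a)
    then have "act_word us f {#} = 0"
      using val[of us] by (auto simp: f_def)
    then show ?case
      using word h_word[of us] hom(2)[of "S.word us" "S.word us" a f "{#}"] by simp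
  qed (simp_all add: h0 hom low_closed)
  moreover have "act_word ws f {#} \<noteq> 0"
    using val[of ws] ws by (simp add: f_def)
  ultimately show ?thesis
    using hom(1)[of "c \<odot>\<^bsub>S.PA\<^esub> S.word ws" y f "{#}"] hom(2)[of "S.word ws" "S.word ws" c f "{#}"]
      ws low_closed[OF y] h0 h_word[OF ws] by (simp add: eq)
qed

section \<open>The multiplicative leading term map on S\<close>

definition leading :: "(s_gen word \<Rightarrow>\<^sub>0 'k) set \<Rightarrow> (torus_gen word \<Rightarrow>\<^sub>0 'k) set \<Rightarrow> bool" where
  "leading x t \<longleftrightarrow> (\<exists>c ws y. c \<noteq> 0 \<and> set ws \<subseteq> s_gens n r \<and> y \<in> low (mset ws) \<and>
     x = c \<odot>\<^bsub>S.PA\<^esub> S.word ws \<oplus>\<^bsub>S.PA\<^esub> y \<and> t = c \<odot>\<^bsub>T\<^esub> symbol ws)"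

lemma leading_closed:
  assumes "leading x t"
  shows "x \<in> carrier S.PA - {\<zero>\<^bsub>S.PA\<^esub>}" "t \<in> Units T"
proof -
  obtain c ws y where *: "c \<noteq> 0" "set ws \<subseteq> s_gens n r" "y \<in> low (mset ws)"
     "x = c \<odot>\<^bsub>S.PA\<^esub> S.word ws \<oplus>\<^bsub>S.PA\<^esub> y" "t = c \<odot>\<^bsub>T\<^esub> symbol ws"
    using assms unfolding leading_def by blast
  show "x \<in> carrier S.PA - {\<zero>\<^bsub>S.PA\<^esub>}"
    using low_leading_coeff[OF *(2,3), of c] * low_closed[OF *(3)] by auto
  show "t \<in> Units T"
    using * symbol_Units T.smult_Units by blast
qed

lemma leading_word: "set ws \<subseteq> s_gens n r \<Longrightarrow> leading (S.word ws) (symbol ws)"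
  unfolding leading_def
  by (intro exI[of _ 1] exI[of _ ws] exI[of _ "\<zero>\<^bsub>S.PA\<^esub>"]) (simp add: low.zero)

lemma leading_smult:
  assumes "leading x t" "a \<noteq> 0"
  shows "leading (a \<odot>\<^bsub>S.PA\<^esub> x) (a \<odot>\<^bsub>T\<^esub> t)"
proof -
  obtain c ws y where *: "c \<noteq> 0" "set ws \<subseteq> s_gens n r" "y \<in> low (mset ws)"
     "x = c \<odot>\<^bsub>S.PA\<^esub> S.word ws \<oplus>\<^bsub>S.PA\<^esub> y" "t = c \<odot>\<^bsub>T\<^esub> symbol ws"
    using assms unfolding leading_def by blast
  then show ?thesis
    unfolding leading_def using assms(2) low_closed[OF *(3)] low_smult[OF *(3), of a]
    by (intro exI[of _ "a * c"] exI[of _ ws] exI[of _ "a \<odot>\<^bsub>S.PA\<^esub> y"])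
       (simp add: S.PA.smult_add_right S.PA.smult_smult T.smult_smult)
qed

text \<open>The order on multisets is compatible with addition, so all cross terms are strictly
  lower, and the top coefficient \<open>c * d\<close> is nonzero.\<close>

lemma leading_mult:
  assumes "leading x s" "leading y t"
  shows "leading (x \<otimes>\<^bsub>S.PA\<^esub> y) (s \<otimes>\<^bsub>T\<^esub> t)"
proof -
  obtain c ws z where c: "c \<noteq> 0" "set ws \<subseteq> s_gens n r" "z \<in> low (mset ws)"
     "x = c \<odot>\<^bsub>S.PA\<^esub> S.word ws \<oplus>\<^bsub>S.PA\<^esub> z" "s = c \<odot>\<^bsub>T\<^esub> symbol ws"
    using assms(1) unfolding leading_def by blast
  obtain d us v where d: "d \<noteq> 0" "set us \<subseteq> s_gens n r" "v \<in> low (mset us)"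
     "y = d \<odot>\<^bsub>S.PA\<^esub> S.word us \<oplus>\<^bsub>S.PA\<^esub> v" "t = d \<odot>\<^bsub>T\<^esub> symbol us"
    using assms(2) unfolding leading_def by blast
  have cl: "z \<in> carrier S.PA" "v \<in> carrier S.PA"
    using c d low_closed by auto
  let ?r = "c \<odot>\<^bsub>S.PA\<^esub> (S.word ws \<otimes>\<^bsub>S.PA\<^esub> v) \<oplus>\<^bsub>S.PA\<^esub>
    (d \<odot>\<^bsub>S.PA\<^esub> (z \<otimes>\<^bsub>S.PA\<^esub> S.word us) \<oplus>\<^bsub>S.PA\<^esub> z \<otimes>\<^bsub>S.PA\<^esub> v)"
  have "?r \<in> low (mset (ws @ us))"
    using low_word_left[OF d(3) c(2)] low_word_right[OF c(3) d(2)] low_mult[OF c(3) d(3)]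
    by (simp add: low.add low_smult)
  moreover have "x \<otimes>\<^bsub>S.PA\<^esub> y = (c * d) \<odot>\<^bsub>S.PA\<^esub> S.word (ws @ us) \<oplus>\<^bsub>S.PA\<^esub> ?r"
    unfolding c(4) d(4) using c(2) d(2) cl
    by (simp add: S.word_append S.PA.l_distr S.PA.r_distr S.PA.smult_mult_left S.PA.smult_mult_right
        S.PA.smult_smult S.PA.smult_add_right S.PA.a_ac mult.commute)
  moreover have "s \<otimes>\<^bsub>T\<^esub> t = (c * d) \<odot>\<^bsub>T\<^esub> symbol (ws @ us)"
    unfolding c(5) d(5) using c(2) d(2) by (simp add: symbol_append T.smult_mult_smult)
  moreover have "set (ws @ us) \<subseteq> s_gens n r"
    using c(2) d(2) by simp
  ultimately show ?thesis
    using c(1) d(1) unfolding leading_def by (metis no_zero_divisors)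
qed

lemma word_coset_reorder:
  assumes "set ws \<subseteq> s_gens n r" "mset ws = mset us"
  obtains c y where "c \<noteq> 0" "y \<in> low (mset us)"
    "S.word ws = c \<odot>\<^bsub>S.PA\<^esub> S.word us \<oplus>\<^bsub>S.PA\<^esub> y" "symbol ws = c \<odot>\<^bsub>T\<^esub> symbol us"
  using reorder_mset[OF assms] that unfolding reorder_def by blast

text \<open>If the top multisets differed, the element would lie strictly below one of its own
  leading words, against \<open>low_leading_coeff\<close>. If they agree, the words are permutations
  of each other and \<open>reorder_mset\<close> compares coefficients and symbols at once.\<close>

lemma leading_unique:
  assumes "leading x s" "leading x t"
  shows "s = t"
proof -
  obtain c ws y where c: "c \<noteq> 0" "set ws \<subseteq> s_gens n r" "y \<in> low (mset ws)"
     "x = c \<odot>\<^bsub>S.PA\<^esub> S.word ws \<oplus>\<^bsub>S.PA\<^esub> y" "s = c \<odot>\<^bsub>T\<^esub> symbol ws"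
    using assms(1) unfolding leading_def by blast
  obtain d us z where d: "d \<noteq> 0" "set us \<subseteq> s_gens n r" "z \<in> low (mset us)"
     "x = d \<odot>\<^bsub>S.PA\<^esub> S.word us \<oplus>\<^bsub>S.PA\<^esub> z" "t = d \<odot>\<^bsub>T\<^esub> symbol us"
    using assms(2) unfolding leading_def by blast
  have cl: "y \<in> carrier S.PA" "z \<in> carrier S.PA" "x \<in> carrier S.PA"
    using c d low_closed by auto
  have cancel: "a = 0"
    if "set vs \<subseteq> s_gens n r" "p \<in> low (mset vs)" "q \<in> low (mset vs)"
      "a \<odot>\<^bsub>S.PA\<^esub> S.word vs \<oplus>\<^bsub>S.PA\<^esub> p = q" for a vs p q
  proof (rule low_leading_coeff[OF that(1)])
    have pq: "p \<in> carrier S.PA" "q \<in> carrier S.PA"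
      using that low_closed by auto
    show "p \<oplus>\<^bsub>S.PA\<^esub> (- 1) \<odot>\<^bsub>S.PA\<^esub> q \<in> low (mset vs)"
      using that by (simp add: low.add low_smult)
    have "q \<oplus>\<^bsub>S.PA\<^esub> (- 1) \<odot>\<^bsub>S.PA\<^esub> q = \<zero>\<^bsub>S.PA\<^esub>"
      using S.PA.smult_add_left[OF pq(2), of 1 "- 1"] pq by simp
    then show "a \<odot>\<^bsub>S.PA\<^esub> S.word vs \<oplus>\<^bsub>S.PA\<^esub> (p \<oplus>\<^bsub>S.PA\<^esub> (- 1) \<odot>\<^bsub>S.PA\<^esub> q) = \<zero>\<^bsub>S.PA\<^esub>"
      using that pq by (simp flip: S.PA.a_assoc)
  qed
  consider "mset ws < mset us" | "mset us < mset ws" | "mset ws = mset us"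
    by (meson linorder_less_linear)
  then show ?thesis
  proof cases
    case 1
    then have "x \<in> low (mset us)"
      using c low_mono[OF c(3)] by (auto intro!: low.intros)
    then show ?thesis
      using cancel[OF d(2,3)] d by metis
  next
    case 2
    then have "x \<in> low (mset ws)"
      using d low_mono[OF d(3)] by (auto intro!: low.intros)
    then show ?thesis
      using cancel[OF c(2,3)] c by metis
  next
    case 3
    \<comment> \<open>After rewriting \<open>ws\<close> into \<open>us\<close> the top coefficients
      are \<open>c * k\<close> and \<open>d\<close>, while the symbols are related by the same
      \<open>k\<close>; equality of coefficients thus gives equality of symbols.\<close>
    obtain k v where k: "k \<noteq> 0" "v \<in> low (mset us)"
      "S.word ws = k \<odot>\<^bsub>S.PA\<^esub> S.word us \<oplus>\<^bsub>S.PA\<^esub> v" "symbol ws = k \<odot>\<^bsub>T\<^esub> symbol us"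
      by (rule word_coset_reorder[OF c(2) 3])
    have v: "v \<in> carrier S.PA"
      using k low_closed by auto
    let ?w = "S.word us" and ?p = "c \<odot>\<^bsub>S.PA\<^esub> v \<oplus>\<^bsub>S.PA\<^esub> y"
    have w: "?w \<in> carrier S.PA"
      using d by simp
    have p: "?p \<in> low (mset us)" "?p \<in> carrier S.PA"
      using k c 3 v cl by (simp_all add: low.add low_smult)
    have "d \<odot>\<^bsub>S.PA\<^esub> ?w \<oplus>\<^bsub>S.PA\<^esub> ((c * k - d) \<odot>\<^bsub>S.PA\<^esub> ?w \<oplus>\<^bsub>S.PA\<^esub> ?p) =
        (d + (c * k - d)) \<odot>\<^bsub>S.PA\<^esub> ?w \<oplus>\<^bsub>S.PA\<^esub> ?p"
      unfolding S.PA.smult_add_left[OF w] using w p by (simp only: S.PA.a_assoc S.PA.smult_cl)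
    also have "\<dots> = x"
      unfolding c(4) k(3) using w v cl
      by (simp add: S.PA.smult_add_right S.PA.smult_smult S.PA.a_assoc)
    finally have "(c * k - d) \<odot>\<^bsub>S.PA\<^esub> ?w \<oplus>\<^bsub>S.PA\<^esub> ?p = z"
      unfolding d(4) using w p cl
        S.PA.add.l_cancel[of "d \<odot>\<^bsub>S.PA\<^esub> ?w" "(c * k - d) \<odot>\<^bsub>S.PA\<^esub> ?w \<oplus>\<^bsub>S.PA\<^esub> ?p" z]
      by blast
    then have "c * k - d = 0"
      by (rule cancel[OF d(2) p(1) d(3)])
    then show ?thesis
      using c(5) d(5) k(4) d(2) by (simp add: T.smult_smult)
  qed
qed

text \<open>The coefficient \<open>c\<close> may be 0, because two summands with the same top
  multiset can cancel. \<open>low_leading\<close> then replaces the element by its strictly lower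
  remainder, and well-foundedness ends the descent.\<close>

lemma low_top_term:
  assumes "x \<in> low M"
  shows "x = \<zero>\<^bsub>S.PA\<^esub> \<or> (\<exists>c ws y. set ws \<subseteq> s_gens n r \<and> mset ws < M \<and> y \<in> low (mset ws) \<and>
    x = c \<odot>\<^bsub>S.PA\<^esub> S.word ws \<oplus>\<^bsub>S.PA\<^esub> y)" (is "_ \<or> ?P x")
  using assms
proof (induction rule: low.induct)
  case zero
  show ?case by simp
next
  case (word ws c)
  then show ?case
    by (intro disjI2 exI[of _ c] exI[of _ ws] exI[of _ "\<zero>\<^bsub>S.PA\<^esub>"]) (simp add: low.zero)
next
  case (add x x')
  have cl: "x \<in> carrier S.PA" "x' \<in> carrier S.PA"
    using add.hyps low_closed by auto
  show ?case
  proof (cases "x = \<zero>\<^bsub>S.PA\<^esub> \<or> x' = \<zero>\<^bsub>S.PA\<^esub>")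
    case True
    then have "x \<oplus>\<^bsub>S.PA\<^esub> x' = x \<or> x \<oplus>\<^bsub>S.PA\<^esub> x' = x'"
      using cl by auto
    then show ?thesis
      using add.IH by metis
  next
    case False
    \<comment> \<open>Stated for arbitrary summands, so that it applies whichever of the two has the
      larger top multiset.\<close>
    have less: "?P (x \<oplus>\<^bsub>S.PA\<^esub> x')"
      if "set ws \<subseteq> s_gens n r" "mset ws < M" "y \<in> low (mset ws)" "x = c \<odot>\<^bsub>S.PA\<^esub> S.word ws \<oplus>\<^bsub>S.PA\<^esub> y"
        "x' \<in> low (mset ws)" "x' \<in> carrier S.PA" for ws c y x x'
      using that low_closed[OF that(3)]
      by (intro exI[of _ c] exI[of _ ws] exI[of _ "y \<oplus>\<^bsub>S.PA\<^esub> x'"])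
         (simp add: low.add S.PA.a_assoc)
    obtain c ws y where c: "set ws \<subseteq> s_gens n r" "mset ws < M" "y \<in> low (mset ws)"
        "x = c \<odot>\<^bsub>S.PA\<^esub> S.word ws \<oplus>\<^bsub>S.PA\<^esub> y"
      using add.IH(1) False by blast
    obtain d us z where d: "set us \<subseteq> s_gens n r" "mset us < M" "z \<in> low (mset us)"
        "x' = d \<odot>\<^bsub>S.PA\<^esub> S.word us \<oplus>\<^bsub>S.PA\<^esub> z"
      using add.IH(2) False by blast
    have zy: "y \<in> carrier S.PA" "z \<in> carrier S.PA"
      using c d low_closed by auto
    consider "mset ws < mset us" | "mset us < mset ws" | "mset ws = mset us"
      by (meson linorder_less_linear)
    then show ?thesis
    proof cases
      case 1
      then have "x \<in> low (mset us)"
        using c low_mono[OF c(3)] by (auto intro!: low.intros)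
      from less[OF d this cl(1)] show ?thesis
        using cl by (simp add: S.PA.a_comm)
    next
      case 2
      then have "x' \<in> low (mset ws)"
        using d low_mono[OF d(3)] by (auto intro!: low.intros)
      from less[OF c this cl(2)] show ?thesis ..
    next
      case 3
      obtain k v where k: "k \<noteq> 0" "v \<in> low (mset us)"
        "S.word ws = k \<odot>\<^bsub>S.PA\<^esub> S.word us \<oplus>\<^bsub>S.PA\<^esub> v"
        by (rule word_coset_reorder[OF c(1) 3])
      have v: "v \<in> carrier S.PA"
        using k low_closed by auto
      have "x \<oplus>\<^bsub>S.PA\<^esub> x' = (c * k + d) \<odot>\<^bsub>S.PA\<^esub> S.word us \<oplus>\<^bsub>S.PA\<^esub>
          (c \<odot>\<^bsub>S.PA\<^esub> v \<oplus>\<^bsub>S.PA\<^esub> (y \<oplus>\<^bsub>S.PA\<^esub> z))"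
        unfolding c(4) d(4) k(3) using v zy d(1)
        by (simp add: S.PA.smult_add_left S.PA.smult_add_right S.PA.smult_smult S.PA.a_ac)
      moreover have "c \<odot>\<^bsub>S.PA\<^esub> v \<oplus>\<^bsub>S.PA\<^esub> (y \<oplus>\<^bsub>S.PA\<^esub> z) \<in> low (mset us)"
        using k c(3) d(3) 3 by (simp add: low.add low_smult)
      ultimately show ?thesis
        using d(1,2) by blast
    qed
  qed
qed

lemma low_leading: "x \<in> low M \<Longrightarrow> x \<noteq> \<zero>\<^bsub>S.PA\<^esub> \<Longrightarrow> \<exists>t. leading x t"
proof (induction M arbitrary: x rule: less_induct)
  case (less M)
  obtain c ws y where c: "set ws \<subseteq> s_gens n r" "mset ws < M" "y \<in> low (mset ws)"
      "x = c \<odot>\<^bsub>S.PA\<^esub> S.word ws \<oplus>\<^bsub>S.PA\<^esub> y"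
    using low_top_term[OF less(2)] less(3) by blast
  show ?case
  proof (cases "c = 0")
    case True
    then have "x = y"
      using c low_closed[OF c(3)] by simp
    then show ?thesis
      using less c by blast
  next
    case False
    then show ?thesis
      using c unfolding leading_def by blast
  qed
qed

lemma ex_low: "x \<in> carrier S.PA \<Longrightarrow> \<exists>M. x \<in> low M"
proof -
  have "\<exists>M. S.proj p \<in> low M" if "p \<in> carrier S.FA" for p
    using that
  proof (induction p rule: S.FA_induct)
    case zero
    show ?case
      using low.zero by auto
  next
    case (single ws c)
    \<comment> \<open>One more letter makes the bound strict. \<open>SY 0\<close> is not a generator
      of \<open>S\<close>, but the bounds range over multisets of arbitrary letters.\<close>
    have "c \<odot>\<^bsub>S.PA\<^esub> S.word ws \<in> low (add_mset (SY 0) (mset ws))"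
      using single by (intro low.word) simp_all
    then show ?case
      using single by (auto simp: S.proj_smult simp flip: S.word_def)
  next
    case (add p q)
    then obtain M N where "S.proj p \<in> low M" "S.proj q \<in> low N"
      by blast
    then have "S.proj p \<in> low (max M N)" "S.proj q \<in> low (max M N)"
      using low_mono by (meson max.cobounded1 max.cobounded2)+
    then show ?case
      using add low.add by (auto simp: S.proj_add)
  qed
  then show "x \<in> carrier S.PA \<Longrightarrow> \<exists>M. x \<in> low M"
    unfolding S.PA_carrier by blast
qed

lemma ex_leading: "x \<in> carrier S.PA - {\<zero>\<^bsub>S.PA\<^esub>} \<Longrightarrow> \<exists>t. leading x t"
  using ex_low low_leading by blast

end



text \<open>Turns a left fraction into a right one; this carries the exchange of denominators over
  to the torus.\<close>

lemma (in monoid) Units_swap_fraction: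
  assumes "x \<in> Units G" "y \<in> Units G" "p \<in> Units G" "q \<in> Units G" "x \<otimes> q = y \<otimes> p"
  shows "inv y \<otimes> x = p \<otimes> inv q"
proof -
  have [simp]: "x \<in> carrier G" "y \<in> carrier G" "p \<in> carrier G" "q \<in> carrier G"
      "inv y \<in> carrier G" "inv q \<in> carrier G"
    using assms by auto
  have "inv y \<otimes> x = inv y \<otimes> (x \<otimes> q) \<otimes> inv q"
    using assms(2,4) by (simp add: m_assoc)
  also have "\<dots> = (inv y \<otimes> y) \<otimes> p \<otimes> inv q"
    unfolding assms(5) by (simp add: m_assoc del: Units_l_inv)
  finally show ?thesis
    using assms(2) by simp
qed

lemma (in monoid) Units_inv_mult:
  assumes "x \<in> Units G" "y \<in> Units G"
  shows "inv (x \<otimes> y) = inv y \<otimes> inv x"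
proof (rule inv_char)
  show "(x \<otimes> y) \<otimes> (inv y \<otimes> inv x) = \<one>"
  proof -
    have "(x \<otimes> y) \<otimes> (inv y \<otimes> inv x) = x \<otimes> (y \<otimes> inv y) \<otimes> inv x"
      using assms by (simp add: m_assoc Units_closed del: Units_r_inv)
    then show ?thesis
      using assms by (simp add: Units_closed)
  qed
  show "(inv y \<otimes> inv x) \<otimes> (x \<otimes> y) = \<one>"
  proof -
    have "(inv y \<otimes> inv x) \<otimes> (x \<otimes> y) = inv y \<otimes> (inv x \<otimes> x) \<otimes> y"
      using assms by (simp add: m_assoc Units_closed del: Units_l_inv)
    then show ?thesis
      using assms by (simp add: Units_closed)
  qed
qed (use assms in auto)

context torus
begin

text \<open>The converse of \<open>ex_torus_hom\<close>: together they replace morphisms out of a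
  torus by tuples of units with prescribed commutation scalars.\<close>

lemma hom_generators:
  assumes A: "k_algebra A" and h: "h \<in> alg_hom T A"
  defines "u \<equiv> \<lambda>i. h (word [TY i])"
  shows "i \<in> {1..n} \<Longrightarrow> u i \<in> Units A"
    and "i \<in> {1..n} \<Longrightarrow> j \<in> {1..n} \<Longrightarrow>
      u i \<otimes>\<^bsub>A\<^esub> u j = \<Lambda> i j \<odot>\<^bsub>A\<^esub> (u j \<otimes>\<^bsub>A\<^esub> u i)"
proof -
  interpret A: k_algebra A by fact
  interpret T: k_algebra T by (rule quantum_torus_k_algebra)
  have cl: "word [TY i] \<in> carrier T" if "i \<in> {1..n}" for i
    using that word_closed[of "[TY i]"] by (simp add: PA_eq)
  have sm: "h (c \<odot>\<^bsub>T\<^esub> x) = c \<odot>\<^bsub>A\<^esub> h x" if "x \<in> carrier T" for c x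
    using h that by (auto simp: alg_hom_def)
  have hom: "h \<in> ring_hom T A"
    using h by (simp add: alg_hom_def)
  {
    assume i: "i \<in> {1..n}"
    have U: "word [TY i] \<in> Units T"
      using i word_gen_Units(1) by simp
    have c: "word [TY i] \<in> carrier T" "inv\<^bsub>T\<^esub> word [TY i] \<in> carrier T"
      using T.Units_closed[OF U] T.Units_inv_closed[OF U] by blast+
    have "h (word [TY i]) \<otimes>\<^bsub>A\<^esub> h (inv\<^bsub>T\<^esub> word [TY i]) = \<one>\<^bsub>A\<^esub>"
      "h (inv\<^bsub>T\<^esub> word [TY i]) \<otimes>\<^bsub>A\<^esub> h (word [TY i]) = \<one>\<^bsub>A\<^esub>"
      using ring_hom_mult[OF hom c] ring_hom_mult[OF hom c(2,1)] ring_hom_one[OF hom] U by simp_all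
    then show "u i \<in> Units A"
      using ring_hom_closed[OF hom c(1)] ring_hom_closed[OF hom c(2)]
      unfolding u_def Units_def by blast
  }
  assume ij: "i \<in> {1..n}" "j \<in> {1..n}"
  have "word [TY i] \<otimes>\<^bsub>T\<^esub> word [TY j] = \<Lambda> i j \<odot>\<^bsub>T\<^esub> (word [TY j] \<otimes>\<^bsub>T\<^esub> word [TY i])"
    using word_gens_commute[of "TY i" "TY j"] ij by (simp add: comm_factor_def)
  from arg_cong[OF this, of h] show "u i \<otimes>\<^bsub>A\<^esub> u j = \<Lambda> i j \<odot>\<^bsub>A\<^esub> (u j \<otimes>\<^bsub>A\<^esub> u i)"
    unfolding u_def
    using ring_hom_mult[OF hom cl[OF ij(1)] cl[OF ij(2)]] ring_hom_mult[OF hom cl[OF ij(2)] cl[OF ij(1)]]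
      sm[OF T.m_closed[OF cl[OF ij(2)] cl[OF ij(1)]]] by simp
qed

end

section \<open>Leading terms of fractions\<close>

locale s_fractions = s_algebra +
  fixes F :: "('a, 'f) module" and \<iota> :: "(s_gen word \<Rightarrow>\<^sub>0 'a) set \<Rightarrow> 'f"
  assumes fractions: "skew_field_of_fractions (S_algebra n r \<Lambda>) F \<iota>"
begin

sublocale F: k_algebra F
  using fractions by (simp add: skew_field_of_fractions_def)

lemma Units_F: "Units F = carrier F - {\<zero>\<^bsub>F\<^esub>}"
  using fractions by (simp add: skew_field_of_fractions_def skew_field_def)

lemma embedding: "\<iota> \<in> alg_hom S.PA F" "inj_on \<iota> (carrier S.PA)"
  using fractions by (simp_all add: skew_field_of_fractions_def S_algebra_eq)

lemma embedding_ring_hom: "\<iota> \<in> ring_hom S.PA F"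
  using embedding by (simp add: alg_hom_def)

lemma embedding_simps:
  assumes "x \<in> carrier S.PA"
  shows "\<iota> x \<in> carrier F" "\<iota> (c \<odot>\<^bsub>S.PA\<^esub> x) = c \<odot>\<^bsub>F\<^esub> \<iota> x"
    and "y \<in> carrier S.PA \<Longrightarrow> \<iota> (x \<otimes>\<^bsub>S.PA\<^esub> y) = \<iota> x \<otimes>\<^bsub>F\<^esub> \<iota> y"
  using embedding assms ring_hom_closed[OF embedding_ring_hom] ring_hom_mult[OF embedding_ring_hom]
  by (auto simp: alg_hom_def)

lemma embedding_Units:
  assumes "x \<in> carrier S.PA - {\<zero>\<^bsub>S.PA\<^esub>}"
  shows "\<iota> x \<in> Units F"
proof -
  have "\<iota> \<zero>\<^bsub>S.PA\<^esub> = \<zero>\<^bsub>F\<^esub>"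
    using embedding_simps(2)[of "\<zero>\<^bsub>S.PA\<^esub>" 0] embedding_simps(1)[of "\<zero>\<^bsub>S.PA\<^esub>"] by simp
  then have "\<iota> x \<noteq> \<zero>\<^bsub>F\<^esub>"
    using assms inj_onD[OF embedding(2), of x "\<zero>\<^bsub>S.PA\<^esub>"] by auto
  then show ?thesis
    using assms embedding_simps(1) by (simp add: Units_F)
qed

lemma leading_Units: "leading x t \<Longrightarrow> \<iota> x \<in> Units F" "leading x t \<Longrightarrow> x \<in> carrier S.PA"
  using embedding_Units leading_closed by auto

text \<open>A relation and not a function, since a unit has many representations as a fraction.
  Uniqueness comes later, out of multiplicativity.\<close>

definition leading_fraction :: "'f \<Rightarrow> (torus_gen word \<Rightarrow>\<^sub>0 'a) set \<Rightarrow> bool" where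
  "leading_fraction u t \<longleftrightarrow> (\<exists>x y s s'. leading x s \<and> leading y s' \<and>
     u = \<iota> x \<otimes>\<^bsub>F\<^esub> inv\<^bsub>F\<^esub> \<iota> y \<and> t = s \<otimes>\<^bsub>T\<^esub> inv\<^bsub>T\<^esub> s')"

lemma ex_leading_fraction:
  assumes "u \<in> Units F"
  shows "\<exists>x y s s'. leading x s \<and> leading y s' \<and> u = \<iota> x \<otimes>\<^bsub>F\<^esub> inv\<^bsub>F\<^esub> \<iota> y"
proof -
  have "u \<in> carrier F"
    using assms by auto
  then obtain x y where x: "x \<in> carrier S.PA" and y: "y \<in> carrier S.PA - {\<zero>\<^bsub>S.PA\<^esub>}"
    and u: "u = \<iota> x \<otimes>\<^bsub>F\<^esub> inv\<^bsub>F\<^esub> \<iota> y"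
    using fractions unfolding skew_field_of_fractions_def S_algebra_eq by blast
  have "x \<noteq> \<zero>\<^bsub>S.PA\<^esub>"
  proof
    assume "x = \<zero>\<^bsub>S.PA\<^esub>"
    then have "\<iota> x = \<zero>\<^bsub>F\<^esub>"
      using embedding_simps(2)[OF x, of 0] embedding_simps(1)[OF x] x by simp
    then have "u = \<zero>\<^bsub>F\<^esub>"
      using embedding_Units[OF y] by (simp add: u)
    then show False
      using assms Units_F by blast
  qed
  then show ?thesis
    using ex_leading[of x] ex_leading[OF y] x u by blast
qed

text \<open>The middle factor of \<open>a b^-1 c d^-1\<close> is a unit of \<open>F\<close>, hence
  itself a right fraction \<open>p q^-1\<close>. The product becomes \<open>(a p) (d q)^-1\<close>,
  provided that the symbols satisfy the same exchange rule.\<close>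

lemma leading_fraction_mult:
  assumes "leading_fraction u s" "leading_fraction v t"
  shows "leading_fraction (u \<otimes>\<^bsub>F\<^esub> v) (s \<otimes>\<^bsub>T\<^esub> t)"
proof -
  obtain a b ta tb where ab: "leading a ta" "leading b tb"
     "u = \<iota> a \<otimes>\<^bsub>F\<^esub> inv\<^bsub>F\<^esub> \<iota> b" "s = ta \<otimes>\<^bsub>T\<^esub> inv\<^bsub>T\<^esub> tb"
    using assms(1) unfolding leading_fraction_def by blast
  obtain c d tc td where cd: "leading c tc" "leading d td"
     "v = \<iota> c \<otimes>\<^bsub>F\<^esub> inv\<^bsub>F\<^esub> \<iota> d" "t = tc \<otimes>\<^bsub>T\<^esub> inv\<^bsub>T\<^esub> td"
    using assms(2) unfolding leading_fraction_def by blast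
  have U1: "\<iota> a \<in> Units F" "\<iota> b \<in> Units F" "\<iota> c \<in> Units F" "\<iota> d \<in> Units F"
    using ab cd leading_Units by auto
  then have "inv\<^bsub>F\<^esub> \<iota> b \<otimes>\<^bsub>F\<^esub> \<iota> c \<in> Units F"
    by simp
  then obtain p q tp tq where pq: "leading p tp" "leading q tq"
      "inv\<^bsub>F\<^esub> \<iota> b \<otimes>\<^bsub>F\<^esub> \<iota> c = \<iota> p \<otimes>\<^bsub>F\<^esub> inv\<^bsub>F\<^esub> \<iota> q"
    using ex_leading_fraction by blast
  have U2: "\<iota> p \<in> Units F" "\<iota> q \<in> Units F"
    using pq leading_Units by auto
  have S: "a \<in> carrier S.PA" "b \<in> carrier S.PA" "c \<in> carrier S.PA" "d \<in> carrier S.PA"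
      "p \<in> carrier S.PA" "q \<in> carrier S.PA"
    using ab cd pq leading_Units(2) by blast+
  have UT: "ta \<in> Units T" "tb \<in> Units T" "tc \<in> Units T" "td \<in> Units T" "tp \<in> Units T" "tq \<in> Units T"
    using ab cd pq leading_closed(2) by blast+
  note clF = U1[THEN F.Units_closed] U2[THEN F.Units_closed]
    U1[THEN F.Units_inv_closed] U2[THEN F.Units_inv_closed]
  note clT = UT[THEN T.Units_closed] UT[THEN T.Units_inv_closed]
  \<comment> \<open>Clearing denominators puts the exchange into \<open>S\<close> as
    \<open>c q = b p\<close>; there multiplicativity and uniqueness of leading terms transport it to
    the torus.\<close>
  have "\<iota> c \<otimes>\<^bsub>F\<^esub> \<iota> q = \<iota> b \<otimes>\<^bsub>F\<^esub> (inv\<^bsub>F\<^esub> \<iota> b \<otimes>\<^bsub>F\<^esub> \<iota> c) \<otimes>\<^bsub>F\<^esub> \<iota> q"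
    using clF U1 by (simp flip: F.m_assoc)
  also have "\<dots> = \<iota> b \<otimes>\<^bsub>F\<^esub> \<iota> p"
    unfolding pq(3) using clF U2 by (simp add: F.m_assoc)
  finally have "\<iota> (c \<otimes>\<^bsub>S.PA\<^esub> q) = \<iota> (b \<otimes>\<^bsub>S.PA\<^esub> p)"
    using S by (simp add: embedding_simps)
  then have "c \<otimes>\<^bsub>S.PA\<^esub> q = b \<otimes>\<^bsub>S.PA\<^esub> p"
    using inj_onD[OF embedding(2)] S by simp
  then have "tc \<otimes>\<^bsub>T\<^esub> tq = tb \<otimes>\<^bsub>T\<^esub> tp"
    using leading_mult[OF cd(1) pq(2)] leading_mult[OF ab(2) pq(1)] leading_unique by metis
  then have T: "inv\<^bsub>T\<^esub> tb \<otimes>\<^bsub>T\<^esub> tc = tp \<otimes>\<^bsub>T\<^esub> inv\<^bsub>T\<^esub> tq"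
    using UT by (intro T.Units_swap_fraction)
  have "u \<otimes>\<^bsub>F\<^esub> v = \<iota> a \<otimes>\<^bsub>F\<^esub> (inv\<^bsub>F\<^esub> \<iota> b \<otimes>\<^bsub>F\<^esub> \<iota> c) \<otimes>\<^bsub>F\<^esub> inv\<^bsub>F\<^esub> \<iota> d"
    unfolding ab(3) cd(3) using clF by (simp add: F.m_assoc)
  also have "\<dots> = \<iota> (a \<otimes>\<^bsub>S.PA\<^esub> p) \<otimes>\<^bsub>F\<^esub> inv\<^bsub>F\<^esub> \<iota> (d \<otimes>\<^bsub>S.PA\<^esub> q)"
    unfolding pq(3) using clF U1 U2 S
    by (simp add: embedding_simps F.m_assoc F.Units_inv_mult)
  finally have 1: "u \<otimes>\<^bsub>F\<^esub> v = \<iota> (a \<otimes>\<^bsub>S.PA\<^esub> p) \<otimes>\<^bsub>F\<^esub> inv\<^bsub>F\<^esub> \<iota> (d \<otimes>\<^bsub>S.PA\<^esub> q)" .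
  have "s \<otimes>\<^bsub>T\<^esub> t = ta \<otimes>\<^bsub>T\<^esub> (inv\<^bsub>T\<^esub> tb \<otimes>\<^bsub>T\<^esub> tc) \<otimes>\<^bsub>T\<^esub> inv\<^bsub>T\<^esub> td"
    unfolding ab(4) cd(4) using clT by (simp add: T.m_assoc)
  also have "\<dots> = (ta \<otimes>\<^bsub>T\<^esub> tp) \<otimes>\<^bsub>T\<^esub> inv\<^bsub>T\<^esub> (td \<otimes>\<^bsub>T\<^esub> tq)"
    unfolding T using clT UT by (simp add: T.m_assoc T.Units_inv_mult)
  finally show ?thesis
    using 1 leading_mult[OF ab(1) pq(1)] leading_mult[OF cd(2) pq(2)]
    unfolding leading_fraction_def by blast
qed

lemma leading_fraction_inv:
  assumes "leading_fraction u t"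
  shows "leading_fraction (inv\<^bsub>F\<^esub> u) (inv\<^bsub>T\<^esub> t)"
proof -
  obtain a b ta tb where ab: "leading a ta" "leading b tb"
     "u = \<iota> a \<otimes>\<^bsub>F\<^esub> inv\<^bsub>F\<^esub> \<iota> b" "t = ta \<otimes>\<^bsub>T\<^esub> inv\<^bsub>T\<^esub> tb"
    using assms(1) unfolding leading_fraction_def by blast
  have "inv\<^bsub>F\<^esub> u = \<iota> b \<otimes>\<^bsub>F\<^esub> inv\<^bsub>F\<^esub> \<iota> a"
    unfolding ab(3) using ab leading_Units by (simp add: F.Units_inv_mult)
  moreover have "inv\<^bsub>T\<^esub> t = tb \<otimes>\<^bsub>T\<^esub> inv\<^bsub>T\<^esub> ta"
    unfolding ab(4) using ab leading_closed(2) by (simp add: T.Units_inv_mult)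
  ultimately show ?thesis
    using ab unfolding leading_fraction_def by blast
qed

lemma leading_fraction_Units:
  assumes "leading_fraction u t"
  shows "u \<in> Units F" "t \<in> Units T"
  using assms leading_Units(1) leading_closed(2) unfolding leading_fraction_def by auto

lemma leading_fraction_one:
  assumes "leading_fraction \<one>\<^bsub>F\<^esub> t"
  shows "t = \<one>\<^bsub>T\<^esub>"
proof -
  obtain a b ta tb where ab: "leading a ta" "leading b tb"
     "\<one>\<^bsub>F\<^esub> = \<iota> a \<otimes>\<^bsub>F\<^esub> inv\<^bsub>F\<^esub> \<iota> b" "t = ta \<otimes>\<^bsub>T\<^esub> inv\<^bsub>T\<^esub> tb"
    using assms(1) unfolding leading_fraction_def by blast
  have U: "\<iota> a \<in> Units F" "\<iota> b \<in> Units F"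
    using ab leading_Units by auto
  have "\<iota> a = (\<iota> a \<otimes>\<^bsub>F\<^esub> inv\<^bsub>F\<^esub> \<iota> b) \<otimes>\<^bsub>F\<^esub> \<iota> b"
    using U by (simp add: F.m_assoc F.Units_closed)
  also have "\<dots> = \<iota> b"
    unfolding ab(3)[symmetric] using U by (simp add: F.Units_closed)
  finally have "a = b"
    using inj_onD[OF embedding(2)] ab leading_Units(2) by blast
  then have "ta = tb"
    using ab leading_unique by blast
  then show ?thesis
    using ab(4) leading_closed(2)[OF ab(2)] by simp
qed

text \<open>Multiplying one leading fraction by the inverse of the other reduces the claim to the
  unit 1, where numerator and denominator coincide by injectivity; no common denominators are
  needed.\<close>

lemma leading_fraction_unique:
  assumes "leading_fraction u s" "leading_fraction u t"
  shows "s = t"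
proof -
  have U: "u \<in> Units F" "s \<in> Units T" "t \<in> Units T"
    using assms leading_fraction_Units by auto
  have "leading_fraction \<one>\<^bsub>F\<^esub> (s \<otimes>\<^bsub>T\<^esub> inv\<^bsub>T\<^esub> t)"
    using leading_fraction_mult[OF assms(1) leading_fraction_inv[OF assms(2)]] U by simp
  then have *: "s \<otimes>\<^bsub>T\<^esub> inv\<^bsub>T\<^esub> t = \<one>\<^bsub>T\<^esub>"
    by (rule leading_fraction_one)
  have "s = (s \<otimes>\<^bsub>T\<^esub> inv\<^bsub>T\<^esub> t) \<otimes>\<^bsub>T\<^esub> t"
    using U by (simp add: T.m_assoc T.Units_closed)
  then show ?thesis
    unfolding * using U by (simp add: T.Units_closed)
qed

lemma leading_fraction_smult:
  assumes "leading_fraction u t" "c \<noteq> 0"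
  shows "leading_fraction (c \<odot>\<^bsub>F\<^esub> u) (c \<odot>\<^bsub>T\<^esub> t)"
proof -
  obtain a b ta tb where ab: "leading a ta" "leading b tb"
     "u = \<iota> a \<otimes>\<^bsub>F\<^esub> inv\<^bsub>F\<^esub> \<iota> b" "t = ta \<otimes>\<^bsub>T\<^esub> inv\<^bsub>T\<^esub> tb"
    using assms(1) unfolding leading_fraction_def by blast
  have U: "\<iota> a \<in> Units F" "\<iota> b \<in> Units F" "ta \<in> Units T" "tb \<in> Units T" "a \<in> carrier S.PA"
    using ab leading_Units leading_closed(2) by auto
  have "c \<odot>\<^bsub>F\<^esub> u = \<iota> (c \<odot>\<^bsub>S.PA\<^esub> a) \<otimes>\<^bsub>F\<^esub> inv\<^bsub>F\<^esub> \<iota> b"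
    unfolding ab(3) using U by (simp add: embedding_simps F.smult_mult_left F.Units_closed)
  moreover have "c \<odot>\<^bsub>T\<^esub> t = (c \<odot>\<^bsub>T\<^esub> ta) \<otimes>\<^bsub>T\<^esub> inv\<^bsub>T\<^esub> tb"
    unfolding ab(4) using U by (simp add: T.smult_mult_left T.Units_closed)
  ultimately show ?thesis
    using ab leading_smult[OF ab(1) assms(2)] unfolding leading_fraction_def by blast
qed

text \<open>Both sides of a commutation relation are products and scalar multiples, so each has an
  obvious leading fraction. Uniqueness turns equality in \<open>F\<close> into the same relation
  among the units \<open>t i\<close>.\<close>

lemma hom_to_F_imp_hom_to_T:
  assumes "mult_antisymmetric m M" "alg_hom (quantum_torus m M) F \<noteq> {}"
  shows "alg_hom (quantum_torus m M) T \<noteq> {}"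
proof -
  interpret M: torus m M
    by (rule torus.intro) fact
  obtain h where h: "h \<in> alg_hom M.T F"
    using assms(2) by blast
  define u where "u i = h (M.word [TY i])" for i
  have u: "u i \<in> Units F" if "i \<in> {1..m}" for i
    using M.hom_generators(1)[OF F.k_algebra_axioms h that] by (simp add: u_def)
  have rel: "u i \<otimes>\<^bsub>F\<^esub> u j = M i j \<odot>\<^bsub>F\<^esub> (u j \<otimes>\<^bsub>F\<^esub> u i)" if "i \<in> {1..m}" "j \<in> {1..m}" for i j
    using M.hom_generators(2)[OF F.k_algebra_axioms h that] by (simp add: u_def)
  have "\<exists>t. leading_fraction (u i) t" if "i \<in> {1..m}" for i
    using ex_leading_fraction[OF u[OF that]] unfolding leading_fraction_def by blast
  then obtain t where t: "leading_fraction (u i) (t i)" if "i \<in> {1..m}" for i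
    by metis
  have "t i \<otimes>\<^bsub>T\<^esub> t j = M i j \<odot>\<^bsub>T\<^esub> (t j \<otimes>\<^bsub>T\<^esub> t i)" if ij: "i \<in> {1..m}" "j \<in> {1..m}" for i j
  proof (rule leading_fraction_unique)
    show "leading_fraction (u i \<otimes>\<^bsub>F\<^esub> u j) (t i \<otimes>\<^bsub>T\<^esub> t j)"
      using leading_fraction_mult t ij by blast
    show "leading_fraction (u i \<otimes>\<^bsub>F\<^esub> u j) (M i j \<odot>\<^bsub>T\<^esub> (t j \<otimes>\<^bsub>T\<^esub> t i))"
      unfolding rel[OF ij]
      using leading_fraction_smult leading_fraction_mult t ij M.Lambda(1)[OF ij] by blast
  qed
  moreover have "t i \<in> Units T" if "i \<in> {1..m}" for i
    using leading_fraction_Units(2)[OF t[OF that]] .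
  ultimately have "\<exists>h. h \<in> alg_hom (quantum_torus m M) T"
    using ex_torus_hom[OF T.k_algebra_axioms, of m t M] by blast
  then show ?thesis
    by blast
qed

section \<open>Embedding the torus into the skew field of fractions\<close>

lemma ex_hom_T_F: "\<exists>h. h \<in> alg_hom T F"
proof (rule ex_torus_hom[OF F.k_algebra_axioms])
  fix i assume i: "i \<in> {1..n}"
  then show "\<iota> (S.word [SY i]) \<in> Units F"
    by (intro leading_Units(1)[OF leading_word]) simp
  fix j assume j: "j \<in> {1..n}"
  have "S.word [SY i] \<otimes>\<^bsub>S.PA\<^esub> S.word [SY j] = \<Lambda> i j \<odot>\<^bsub>S.PA\<^esub> (S.word [SY j] \<otimes>\<^bsub>S.PA\<^esub> S.word [SY i])"
    using s_word_YY[OF i j] S.word_append[of "[SY i]" "[SY j]"] S.word_append[of "[SY j]" "[SY i]"] i j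
    by simp
  from arg_cong[OF this, of \<iota>]
  show "\<iota> (S.word [SY i]) \<otimes>\<^bsub>F\<^esub> \<iota> (S.word [SY j]) =
      \<Lambda> i j \<odot>\<^bsub>F\<^esub> (\<iota> (S.word [SY j]) \<otimes>\<^bsub>F\<^esub> \<iota> (S.word [SY i]))"
    using i j by (simp add: embedding_simps)
qed

lemma one_neq_zero_F: "\<one>\<^bsub>F\<^esub> \<noteq> \<zero>\<^bsub>F\<^esub>"
  using Units_F F.Units_one_closed by blast

lemma hom_one_zero:
  assumes "h \<in> alg_hom T F"
  shows "h \<one>\<^bsub>T\<^esub> = \<one>\<^bsub>F\<^esub>" "h \<zero>\<^bsub>T\<^esub> = \<zero>\<^bsub>F\<^esub>"
  using assms ring_hom_one[of h T F] ring_hom_zero[of h T F] T.ring_axioms F.ring_axioms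
  by (auto simp: alg_hom_def)

text \<open>A morphism to the nonzero ring \<open>F\<close> preserves 0 and 1, so the torus cannot
  collapse; this supplies the nontriviality required by \<open>simple_torus\<close>.\<close>

lemma one_neq_zero_T: "\<one>\<^bsub>T\<^esub> \<noteq> \<zero>\<^bsub>T\<^esub>"
  using ex_hom_T_F hom_one_zero one_neq_zero_F by metis

lemma ex_subalgebra_iso:
  assumes simple: "simple_algebra T"
  shows "\<exists>B. is_subalgebra B F \<and> alg_iso T (F\<lparr>carrier := B\<rparr>) \<noteq> {}"
proof -
  obtain h where h: "h \<in> alg_hom T F"
    using ex_hom_T_F by blast
  then have hr: "h \<in> ring_hom T F" and sm: "\<And>c x. x \<in> carrier T \<Longrightarrow> h (c \<odot>\<^bsub>T\<^esub> x) = c \<odot>\<^bsub>F\<^esub> h x"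
    by (auto simp: alg_hom_def)
  interpret h: ring_hom_ring T F h
    by (intro ring_hom_ringI2 T.ring_axioms F.ring_axioms hr)
  define B where "B = h ` carrier T"
  \<comment> \<open>The kernel misses 1, so by simplicity this proper ideal is zero and
    \<open>h\<close> is injective.\<close>
  have "a_kernel T F h \<noteq> carrier T"
    using hom_one_zero(1)[OF h] one_neq_zero_F T.one_closed unfolding a_kernel_def' by force
  then have "a_kernel T F h = {\<zero>\<^bsub>T\<^esub>}"
    using simple h.kernel_is_ideal unfolding simple_algebra_def by blast
  then have inj: "inj_on h (carrier T)"
    by (rule h.trivial_ker_imp_inj)
  have sub: "subring B F"
  proof (rule F.subringI)
    show "\<one>\<^bsub>F\<^esub> \<in> B"
      unfolding B_def by (rule image_eqI[of _ _ "\<one>\<^bsub>T\<^esub>"]) simp_all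
    fix x y assume "x \<in> B" "y \<in> B"
    then obtain a b where ab: "x = h a" "y = h b" "a \<in> carrier T" "b \<in> carrier T"
      unfolding B_def by blast
    show "\<ominus>\<^bsub>F\<^esub> x \<in> B"
      unfolding B_def using ab by (intro image_eqI[of _ _ "\<ominus>\<^bsub>T\<^esub> a"]) simp_all
    show "x \<otimes>\<^bsub>F\<^esub> y \<in> B"
      unfolding B_def using ab by (intro image_eqI[of _ _ "a \<otimes>\<^bsub>T\<^esub> b"]) simp_all
    show "x \<oplus>\<^bsub>F\<^esub> y \<in> B"
      unfolding B_def using ab by (intro image_eqI[of _ _ "a \<oplus>\<^bsub>T\<^esub> b"]) simp_all
  qed (auto simp: B_def)
  have "c \<odot>\<^bsub>F\<^esub> x \<in> B" if "x \<in> B" for c x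
    using that unfolding B_def by (auto simp flip: sm)
  then have "is_subalgebra B F"
    using sub by (simp add: is_subalgebra_def)
  moreover have "h \<in> ring_hom T (F\<lparr>carrier := B\<rparr>)"
    by (rule ring_hom_memI) (auto simp: B_def)
  then have "h \<in> alg_iso T (F\<lparr>carrier := B\<rparr>)"
    using sm inj by (simp add: alg_iso_def alg_hom_def bij_betw_def B_def)
  ultimately show ?thesis
    by blast
qed

end

theorem mainTheorem5:
  fixes n r :: nat
    and \<Lambda> :: "nat \<Rightarrow> nat \<Rightarrow> 'k::field_char_0"
    and F :: "('k, 'f) module"
    and \<iota> :: "(s_gen word \<Rightarrow>\<^sub>0 'k) set \<Rightarrow> 'f"
  assumes "1 \<le> n" and "r \<le> n"
    and "mult_antisymmetric n \<Lambda>"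
    and "simple_algebra (quantum_torus n \<Lambda>)
       \<or> centre (quantum_torus n \<Lambda>) = scalars (quantum_torus n \<Lambda>)
       \<or> \<not> (\<exists>\<alpha> :: nat \<Rightarrow> int. (\<exists>i\<in>{1..n}. \<alpha> i \<noteq> 0) \<and>
              (\<forall>j\<in>{1..n}. (\<Prod>i=1..n. \<Lambda> i j powi \<alpha> i) = 1))"
    and "skew_field_of_fractions (S_algebra n r \<Lambda>) F \<iota>"
  shows "maximal_quantum_subtorus n \<Lambda> F \<and> simple_algebra (quantum_torus n \<Lambda>)"
proof -
  interpret s_fractions n \<Lambda> r F \<iota>
    using assms by unfold_locales
  \<comment> \<open>The first alternative is the claim itself, and the third is
    \<open>independent\<close> unfolded; the other two both go through
    \<open>simple_torus\<close>.\<close>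
  have simple: "simple_algebra T"
    using assms(4) simple_torus[OF one_neq_zero_T] unfolding independent_def by blast
  then show ?thesis
    using ex_subalgebra_iso hom_to_F_imp_hom_to_T unfolding maximal_quantum_subtorus_def by blast
qed

end
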